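(* Let $\alpha\in(0,2)\setminus\{1\}$, $a>0$ and $\frac{1}{1+\alpha}<\beta<1$, and put $c_1=(a(1-\beta))^{\frac1{1-\beta}}$ and $r=\frac{\alpha+\beta-1}{\alpha}$. Let $B_\alpha$ be a strictly $\alpha$-stable process with Lévy measure $(c_+\mathbf 1_{u>0}+c_-\mathbf 1_{u<0})|u|^{-1-\alpha}\,du$, where $c_+,c_-\ge 0$ and $c_++c_->0$. Let $f:\mathbb R\to\mathbb R$ be a $\mathcal C^1$ function such that, as $x\to+\infty$, $(\ln f)'(x)=O(1/x)$ and $f(x)=ax^\beta+o(x^{\beta-r})$. Let $X$ be a solution of the stochastic differential equation $$dX(t)=f(X(t))\,dt+dB_\alpha(t),\qquad t\ge 0,$$ and assume that $\lim_{t\to\infty}X(t)=+\infty$ almost surely. Then the family of random variables indexed by $\lambda>0$ $$\frac{X(\lambda)-c_1\lambda^{\frac1{1-\beta}}}{\lambda^{1/\alpha}}$$ does not converge in distribution as $\lambda\to+\infty$.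
   Context: A strictly $\alpha$-stable process is a Lévy process $B_\alpha$ with $B_\alpha(0)=0$ such that $(B_\alpha(\lambda t))_{t\ge0}$ and $(\lambda^{1/\alpha}B_\alpha(t))_{t\ge0}$ have the same law for every $\lambda>0$ (for $\alpha<1$ it is the sum of its jumps, with no drift; for $\alpha>1$ it is a centred, fully compensated jump process). A solution $X$ of the SDE is a càdlàg process, adapted to a filtration with respect to which $B_\alpha$ is a Lévy process, defined for all $t\ge0$ and satisfying $X(t)=X(0)+\int_0^t f(X(s))\,ds+B_\alpha(t)$. The condition on $(\ln f)'=f'/f$ concerns large $x$, where $f>0$. *)

theory Defs
  imports "HOL-Probability.Probability" "HOL-Library.Landau_Symbols"
begin

text \<open>
  Real-valued processes on a probability space \<open>M\<close> are functions \<open>X :: real \<Rightarrow> 'a \<Rightarrow> real\<close>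
  of which only the times \<open>t \<ge> 0\<close> matter. The library's filtrations, when indexed by the type
  \<^typ>\<open>real\<close>, also carry negative times; these are never used, and any filtration indexed by
  \<open>[0, \<infinity>)\<close> extends by \<open>F t = F 0\<close> for \<open>t < 0\<close>. No completeness or right-continuity is assumed.
\<close>

definition filtration_on :: "'a measure \<Rightarrow> (real \<Rightarrow> 'a measure) \<Rightarrow> bool" where
  "filtration_on M F \<longleftrightarrow> filtration (space M) F \<and> (\<forall>t. subalgebra M (F t))"

definition adapted :: "(real \<Rightarrow> 'a measure) \<Rightarrow> (real \<Rightarrow> 'a \<Rightarrow> real) \<Rightarrow> bool" where
  "adapted F X \<longleftrightarrow> (\<forall>t\<ge>0. X t \<in> borel_measurable (F t))"

definition cadlag :: "(real \<Rightarrow> real) \<Rightarrow> bool" where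
  "cadlag x \<longleftrightarrow>
     (\<forall>t\<ge>0. (x \<longlongrightarrow> x t) (at_right t)) \<and> (\<forall>t>0. \<exists>l. (x \<longlongrightarrow> l) (at_left t))"

text \<open>Levy process with respect to the filtration \<open>F\<close>; path properties hold almost surely.\<close>

definition levy_process ::
  "'a measure \<Rightarrow> (real \<Rightarrow> 'a measure) \<Rightarrow> (real \<Rightarrow> 'a \<Rightarrow> real) \<Rightarrow> bool" where
  "levy_process M F B \<longleftrightarrow>
     adapted F B \<and>
     (AE \<omega> in M. B 0 \<omega> = 0) \<and>
     (AE \<omega> in M. cadlag (\<lambda>t. B t \<omega>)) \<and>
     (\<forall>s t. 0 \<le> s \<and> s \<le> t \<longrightarrow>
        prob_space.indep_set M (sets (F s))
          (sets (vimage_algebra (space M) (\<lambda>\<omega>. B t \<omega> - B s \<omega>) borel))) \<and>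
     (\<forall>s t. 0 \<le> s \<and> s \<le> t \<longrightarrow>
        distr M borel (\<lambda>\<omega>. B t \<omega> - B s \<omega>) = distr M borel (B (t - s)))"

text \<open>The law of a process, as a probability measure on the product space \<open>\<real>\<^bsup>[0, \<infinity>)\<^esup>\<close>.\<close>

definition process_law :: "'a measure \<Rightarrow> (real \<Rightarrow> 'a \<Rightarrow> real) \<Rightarrow> (real \<Rightarrow> real) measure" where
  "process_law M X = distr M (Pi\<^sub>M {0..} (\<lambda>_. borel)) (\<lambda>\<omega>. \<lambda>t\<in>{0..}. X t \<omega>)"

definition strictly_stable_process ::
  "'a measure \<Rightarrow> (real \<Rightarrow> 'a measure) \<Rightarrow> real \<Rightarrow> (real \<Rightarrow> 'a \<Rightarrow> real) \<Rightarrow> bool" where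
  "strictly_stable_process M F \<alpha> B \<longleftrightarrow>
     levy_process M F B \<and>
     (\<forall>c>0. process_law M (\<lambda>t. B (c * t)) =
            process_law M (\<lambda>t \<omega>. c powr (1 / \<alpha>) * B t \<omega>))"

text \<open>
  \<open>\<nu>\<close> is the Levy measure of \<open>B\<close>, i.e. the jump component of its generating triplet
  \<open>(b, \<sigma>\<^sup>2, \<nu>)\<close> in the Levy--Khintchine representation of its characteristic functions.
  The drift \<open>b\<close> (relative to the truncation at \<open>1\<close>) and the Gaussian variance are left free here;
  for a strictly \<open>\<alpha>\<close>-stable process with \<open>0 < \<alpha> < 2\<close>, \<open>\<alpha> \<noteq> 1\<close>, both are determined by the
  scaling property: no Gaussian part, no drift besides the jumps if \<open>\<alpha> < 1\<close>, and full
  compensation if \<open>\<alpha> > 1\<close>.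
\<close>

definition levy_khintchine_exponent ::
  "real \<Rightarrow> real \<Rightarrow> real measure \<Rightarrow> real \<Rightarrow> complex" where
  "levy_khintchine_exponent b \<sigma> \<nu> u =
     \<i> * of_real (b * u) - of_real (\<sigma>\<^sup>2 * u\<^sup>2 / 2) +
     (CLINT x|\<nu>. iexp (u * x) - 1 - \<i> * of_real (u * x * indicator {-1..1} x))"

definition has_levy_measure ::
  "'a measure \<Rightarrow> (real \<Rightarrow> 'a \<Rightarrow> real) \<Rightarrow> real measure \<Rightarrow> bool" where
  "has_levy_measure M B \<nu> \<longleftrightarrow>
     sets \<nu> = sets borel \<and> emeasure \<nu> {0} = 0 \<and> integrable \<nu> (\<lambda>x. min 1 (x\<^sup>2)) \<and>
     (\<exists>b \<sigma>. \<forall>t\<ge>0. \<forall>u.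
        char (distr M borel (B t)) u = exp (of_real t * levy_khintchine_exponent b \<sigma> \<nu> u))"

definition stable_levy_measure :: "real \<Rightarrow> real \<Rightarrow> real \<Rightarrow> real measure" where
  "stable_levy_measure \<alpha> c_pos c_neg =
     density lborel (\<lambda>u. ennreal
       ((c_pos * indicator {0<..} u + c_neg * indicator {..<0} u) * \<bar>u\<bar> powr (- 1 - \<alpha>)))"

definition sde_solution ::
  "'a measure \<Rightarrow> (real \<Rightarrow> 'a measure) \<Rightarrow> (real \<Rightarrow> real) \<Rightarrow> (real \<Rightarrow> 'a \<Rightarrow> real) \<Rightarrow>
   (real \<Rightarrow> 'a \<Rightarrow> real) \<Rightarrow> bool" where
  "sde_solution M F f B X \<longleftrightarrow>
     adapted F X \<and>
     (AE \<omega> in M. cadlag (\<lambda>t. X t \<omega>)) \<and>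
     (AE \<omega> in M. \<forall>t\<ge>0. X t \<omega> = X 0 \<omega> + (LBINT s:{0..t}. f (X s \<omega>)) + B t \<omega>)"

text \<open>
  The library's \<^const>\<open>weak_conv_m\<close> is about sequences of laws; this is the same notion
  (convergence of the distribution functions at the continuity points of a proper limit)
  along an arbitrary filter.
\<close>

definition converges_in_distribution ::
  "'a measure \<Rightarrow> ('i \<Rightarrow> 'a \<Rightarrow> real) \<Rightarrow> 'i filter \<Rightarrow> bool" where
  "converges_in_distribution M Z G \<longleftrightarrow>
     (\<exists>\<mu>. real_distribution \<mu> \<and>
        (\<forall>x. isCont (cdf \<mu>) x \<longrightarrow>
           ((\<lambda>i. cdf (distr M borel (Z i)) x) \<longlongrightarrow> cdf \<mu> x) G))"

end

(*
  Compare the solution at times t and ratio * t, where ratio > 1 is fixed. Write Y(s) = X(s) - g(s),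
  where g(s) = c1 s^p solves g' = a g^beta, and gamma = beta / (1 - beta) = p - 1. Linearising the drift
  around g gives dY = (gamma / s) Y ds + dB up to negligible terms, so that, with Z(s) = Y(s) / s^(1/alpha),

    ratio^(1/alpha - gamma) Z(ratio t) = Z(t) + N(t) + R(t),

  where N(t) is a multiple of the integral of s^(-gamma) dB(s) over [t, ratio t], hence independent of
  Z(t), and R(t) tends to 0 in probability as soon as Z is tight. By scaling, the characteristic function
  of N(t) is bounded at each u different from 0 by a constant q(u) < 1 not depending on t. If Z converged
  in law, the characteristic function phi of the limit would satisfy |phi(d u)| <= q(u) |phi(u)| with
  d = ratio^(1/alpha - gamma) < 1, because beta > 1/(1 + alpha) means gamma > 1/alpha. Iterating,
  |phi(u)| >= |phi(d^n u)| -> 1, so |phi| = 1 everywhere, which contradicts q(u) < 1.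

  The stochastic integral is never constructed: R(t) is the pathwise limit of
  ratio^(1/alpha - gamma) Z(ratio t) - Z(t) - (Riemann sums of N(t)).
*)

theory Submission
  imports Defs
begin

section \<open>Cadlag paths and Stieltjes sums\<close>

text \<open>The exponent r marks the size of perturbation of the drift that stays invisible: along x
  = g(s) an error o(x^(\<beta>-r)) is o(s^(1/\<alpha>-1)), and its integral over [t, ratio t] is
  o(t^(1/\<alpha>)), below the normalisation. The quadratic error of the linearisation has order Y^2
  / (s g(s)), negligible once Y = O(t^(1/\<alpha>)) because 1/\<alpha> < p. The obstacle is that
  tightness of Z controls Y only at the single time t, while R(t) involves the whole window. Two a
  priori bounds bridge the gap: first |Y| <= g(t)/2, which makes X comparable with g so that powers
  of X can be estimated, then |Y| = O(t^(1/\<alpha>)). Both are pathwise and use only bounds on Y(t)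
  and on B over [0, 2t]. The time from which they hold depends on the path, so dominated convergence
  is what turns them into a statement on expectations. Only moduli of characteristic functions
  occur, so the law of N(t) is never computed: stable scaling determines the real part of the
  exponent up to a factor on each half-line, and that is enough.\<close>

lemma right_continuous_seq:
  fixes x :: "real \<Rightarrow> real"
  assumes "(x \<longlongrightarrow> x t) (at_right t)" "\<And>n. t \<le> u n" "u \<longlonglongrightarrow> t"
  shows "(\<lambda>n. x (u n)) \<longlonglongrightarrow> x t"
proof -
  have "at t within {t..} = at t within {t<..}"
    by (rule at_within_nhd[of t UNIV]) auto
  then have "continuous (at t within {t..}) x"
    using assms(1) by (simp add: continuous_within)
  from continuous_within_tendsto_compose'[OF this _ assms(3)] assms(2) show ?thesis by simp
qed

text \<open>Compactness: points where |x| exceeds every n would accumulate at some l, but the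
  one-sided limits bound x near l. The guard \<open>0 \<le> v\<close> appears because
  \<open>cadlag\<close> says nothing about negative times, which are to the left of l = 0.\<close>

lemma cadlag_bounded:
  assumes "cadlag x"
  shows "\<exists>C. \<forall>s\<in>{0..T}. \<bar>x s\<bar> \<le> C"
proof (rule ccontr)
  assume "\<not> ?thesis"
  then have "\<exists>s\<in>{0..T}. real n < \<bar>x s\<bar>" for n :: nat
    by (meson linorder_not_le)
  then obtain s where s: "\<And>n. s n \<in> {0..T}" "\<And>n. real n < \<bar>x (s n)\<bar>" by metis
  obtain l r where l: "l \<in> {0..T}" "strict_mono (r :: nat \<Rightarrow> nat)" "(s \<circ> r) \<longlonglongrightarrow> l"
    using compact_Icc[of 0 T] s(1) unfolding compact_def by metis
  have "\<exists>C. eventually (\<lambda>v. 0 \<le> v \<longrightarrow> \<bar>x v\<bar> \<le> C) (nhds l)"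
  proof -
    from assms l(1) have "(x \<longlongrightarrow> x l) (at_right l)" by (auto simp: cadlag_def)
    then have "((\<lambda>v. \<bar>x v\<bar>) \<longlongrightarrow> \<bar>x l\<bar>) (at_right l)" by (rule tendsto_rabs)
    then have 1: "eventually (\<lambda>v. \<bar>x v\<bar> < \<bar>x l\<bar> + 1) (at_right l)"
      by (rule order_tendstoD) simp
    have "\<exists>C. eventually (\<lambda>v. 0 \<le> v \<longrightarrow> \<bar>x v\<bar> \<le> C) (at_left l)"
    proof (cases "l > 0")
      case True
      then obtain z where "(x \<longlongrightarrow> z) (at_left l)" using assms by (auto simp: cadlag_def)
      then have "((\<lambda>v. \<bar>x v\<bar>) \<longlongrightarrow> \<bar>z\<bar>) (at_left l)" by (rule tendsto_rabs)
      then have "eventually (\<lambda>v. \<bar>x v\<bar> < \<bar>z\<bar> + 1) (at_left l)"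
        by (rule order_tendstoD) simp
      then have "eventually (\<lambda>v. 0 \<le> v \<longrightarrow> \<bar>x v\<bar> \<le> \<bar>z\<bar> + 1) (at_left l)"
        by eventually_elim auto
      then show ?thesis by blast
    next
      case False
      with l(1) have "l = 0" by auto
      then have "eventually (\<lambda>v. v < 0) (at_left l)"
        by (auto simp: eventually_at_filter)
      then have "eventually (\<lambda>v. 0 \<le> v \<longrightarrow> \<bar>x v\<bar> \<le> 0) (at_left l)"
        by eventually_elim auto
      then show ?thesis by blast
    qed
    then obtain C where C: "eventually (\<lambda>v. 0 \<le> v \<longrightarrow> \<bar>x v\<bar> \<le> C) (at_left l)" by blast
    let ?C = "max C (\<bar>x l\<bar> + 1)"
    have "eventually (\<lambda>v. 0 \<le> v \<longrightarrow> \<bar>x v\<bar> \<le> ?C) (at_left l)"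
      using C by eventually_elim auto
    moreover have "eventually (\<lambda>v. 0 \<le> v \<longrightarrow> \<bar>x v\<bar> \<le> ?C) (at_right l)"
      using 1 by eventually_elim auto
    ultimately have "eventually (\<lambda>v. 0 \<le> v \<longrightarrow> \<bar>x v\<bar> \<le> ?C) (nhds l)"
      unfolding eventually_nhds_conv_at eventually_at_split by auto
    then show ?thesis by blast
  qed
  then obtain C where C: "eventually (\<lambda>v. 0 \<le> v \<longrightarrow> \<bar>x v\<bar> \<le> C) (nhds l)" by blast
  have "eventually (\<lambda>n. 0 \<le> s (r n) \<longrightarrow> \<bar>x (s (r n))\<bar> \<le> C) sequentially"
    using filterlim_iff[THEN iffD1, OF l(3), rule_format, OF C] by simp
  moreover have "eventually (\<lambda>n. C < real (r n)) sequentially"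
    using filterlim_compose[OF filterlim_real_sequentially filterlim_subseq[OF l(2)]]
    by (simp add: filterlim_at_top_dense)
  ultimately have "eventually (\<lambda>n. False) sequentially"
    by eventually_elim (metis atLeastAtMost_iff less_asym' linorder_not_less order_less_le_trans s)
  then show False by simp
qed

text \<open>The two sequences are the right and left ends of the cell of width d/m that contains s,
  so both lie within d/m of s.\<close>

lemma ceiling_grid_tendsto:
  fixes s d :: real
  assumes "0 < d"
  shows "(\<lambda>m. d * real_of_int \<lceil>s * real m / d\<rceil> / real m) \<longlonglongrightarrow> s"
    and "(\<lambda>m. d * (real_of_int \<lceil>s * real m / d\<rceil> - 1) / real m) \<longlonglongrightarrow> s"
proof -
  have b: "s \<le> d * real_of_int \<lceil>s * real m / d\<rceil> / real m"
    "d * (real_of_int \<lceil>s * real m / d\<rceil> - 1) / real m \<le> s"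
    "d * real_of_int \<lceil>s * real m / d\<rceil> / real m \<le> s + d / real m"
    "s - d / real m \<le> d * (real_of_int \<lceil>s * real m / d\<rceil> - 1) / real m" if "m > 0" for m
  proof -
    define c where "c = real_of_int \<lceil>s * real m / d\<rceil>"
    have 1: "s * real m / d \<le> c" "c \<le> s * real m / d + 1" unfolding c_def by linarith+
    have 2: "s * real m \<le> d * c" "d * c \<le> s * real m + d"
      using 1 assms by (simp_all add: field_simps)
    show "s \<le> d * real_of_int \<lceil>s * real m / d\<rceil> / real m"
      "d * (real_of_int \<lceil>s * real m / d\<rceil> - 1) / real m \<le> s"
      "d * real_of_int \<lceil>s * real m / d\<rceil> / real m \<le> s + d / real m"
      "s - d / real m \<le> d * (real_of_int \<lceil>s * real m / d\<rceil> - 1) / real m"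
      unfolding c_def[symmetric] using 2 that by (simp_all add: field_simps)
  qed
  have z: "(\<lambda>m. d / real m) \<longlonglongrightarrow> 0"
    by (rule real_tendsto_divide_at_top[OF tendsto_const filterlim_real_sequentially])
  show "(\<lambda>m. d * real_of_int \<lceil>s * real m / d\<rceil> / real m) \<longlonglongrightarrow> s"
    by (rule tendsto_sandwich[OF _ _ tendsto_const, of _ _ _ "\<lambda>m. s + d / real m"])
       (use b z in \<open>auto intro!: eventually_mono[OF eventually_gt_at_top[of 0]] tendsto_eq_intros\<close>)
  show "(\<lambda>m. d * (real_of_int \<lceil>s * real m / d\<rceil> - 1) / real m) \<longlonglongrightarrow> s"
    by (rule tendsto_sandwich[OF _ _ _ tendsto_const, of "\<lambda>m. s - d / real m"])
       (use b z in \<open>auto intro!: eventually_mono[OF eventually_gt_at_top[of 0]] tendsto_eq_intros\<close>)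
qed

text \<open>Sampling x at the next grid point on the right gives functions of an integer-valued
  measurable map; right-continuity makes them converge pointwise.\<close>

lemma cadlag_measurable:
  assumes "cadlag x"
  shows "(\<lambda>s. x (max 0 s)) \<in> borel_measurable borel"
proof (rule borel_measurable_LIMSEQ_real)
  let ?c = "\<lambda>n s. \<lceil>max 0 s * real (Suc n) / 1\<rceil>"
  fix s :: real
  have 1: "(\<lambda>n. 1 * real_of_int (?c n s) / real (Suc n)) \<longlonglongrightarrow> max 0 s"
    using LIMSEQ_Suc[OF ceiling_grid_tendsto(1)[of 1 "max 0 s"]] zero_less_one by blast
  have 2: "max 0 s \<le> 1 * real_of_int (?c n s) / real (Suc n)" for n
    using le_of_int_ceiling[of "max 0 s * real (Suc n) / 1"]
    by (subst pos_le_divide_eq) (simp_all del: of_nat_Suc le_of_int_ceiling)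
  have 3: "(x \<longlongrightarrow> x (max 0 s)) (at_right (max 0 s))"
    using assms by (auto simp: cadlag_def)
  show "(\<lambda>n. x (1 * real_of_int (?c n s) / real (Suc n))) \<longlonglongrightarrow> x (max 0 s)"
    by (rule right_continuous_seq[OF 3 2 1])
next
  fix n
  have 1: "(\<lambda>s. \<lceil>max 0 s * real (Suc n) / 1\<rceil>) \<in> measurable borel (count_space UNIV)"
    by measurable
  have 2: "(\<lambda>k. x (1 * real_of_int k / real (Suc n))) \<in> measurable (count_space UNIV) borel"
    by simp
  show "(\<lambda>s. x (1 * real_of_int \<lceil>max 0 s * real (Suc n) / 1\<rceil> / real (Suc n))) \<in> borel_measurable borel"
    using measurable_compose[OF 1 2] .
qed

lemma bounded_measurable_set_integrable:
  fixes h :: "real \<Rightarrow> real"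
  assumes "h \<in> borel_measurable borel" "\<And>s. s \<in> {u..v} \<Longrightarrow> \<bar>h s\<bar> \<le> C"
  shows "set_integrable lborel {u..v} h"
  unfolding set_integrable_def
  by (rule integrableI_bounded_set_indicator[where B = C]) (use assms in \<open>auto simp: emeasure_lborel_Icc_eq\<close>)

lemma bounded_measurable_integrable_on:
  fixes h :: "real \<Rightarrow> real"
  assumes "h \<in> borel_measurable borel" "\<And>s. s \<in> {u..v} \<Longrightarrow> \<bar>h s\<bar> \<le> C"
  shows "h integrable_on {u..v}"
  using bounded_measurable_set_integrable[OF assms] by (rule set_borel_integral_eq_integral(1))

text \<open>Integration by parts for the integral of w against b, where y differs from b by the
  absolutely continuous part with density h. Abel summation turns the left Riemann sum exactly into
  boundary terms minus the integral of the step approximation \<open>\<Phi> m\<close>, and dominated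
  convergence passes to the limit. No bounded variation of b is required.\<close>

lemma stieltjes_sums_tendsto:
  fixes y h b w w' :: "real \<Rightarrow> real" and t T C :: real
  assumes "t < T"
    and meas[measurable]: "y \<in> borel_measurable borel" "h \<in> borel_measurable borel"
      "w \<in> borel_measurable borel" "w' \<in> borel_measurable borel"
    and y_bound: "\<And>s. s \<in> {t..T} \<Longrightarrow> \<bar>y s\<bar> \<le> C"
    and h_bound: "\<And>s. s \<in> {t..T} \<Longrightarrow> \<bar>h s\<bar> \<le> C"
    and y_right: "\<And>s. s \<in> {t..<T} \<Longrightarrow> (y \<longlongrightarrow> y s) (at_right s)"
    and increment: "\<And>u v. t \<le> u \<Longrightarrow> u \<le> v \<Longrightarrow> v \<le> T \<Longrightarrow>
      y v - y u = integral {u..v} h + (b v - b u)"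
    and w_deriv: "\<And>s. s \<in> {t..T} \<Longrightarrow> (w has_real_derivative w' s) (at s)"
    and w'_cont: "continuous_on {t..T} w'"
  shows "(\<lambda>m. \<Sum>k<m. w (t + (T - t) * real k / real m) *
      (b (t + (T - t) * real (Suc k) / real m) - b (t + (T - t) * real k / real m)))
    \<longlonglongrightarrow> w T * y T - w t * y t - integral {t..T} (\<lambda>s. w s * h s + w' s * y s)"
proof -
  define \<sigma> where "\<sigma> m k = t + (T - t) * real k / real m" for m k :: nat
  \<comment> \<open>On the half-open cell (\<sigma> k, \<sigma> (k+1)] the value is k+1, so
    \<open>up\<close> and \<open>dn\<close> are its right and left ends. At s = t the value is 0 and
    the untruncated left end would fall before t, hence the \<open>max\<close>.\<close>
  define c where "c m s = \<lceil>(s - t) * real m / (T - t)\<rceil>" for m :: nat and s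
  define up where "up m s = min T (t + (T - t) * real_of_int (c m s) / real m)" for m :: nat and s
  define dn where "dn m s = max t (t + (T - t) * (real_of_int (c m s) - 1) / real m)" for m :: nat and s
  \<comment> \<open>The sampling points are dictated by w'y' - wy = w(y' - y) + (w' - w)y', with
    primes for the next grid point: w is taken at the left end and y at the right end, the side on
    which y is continuous.\<close>
  define \<Phi> where "\<Phi> m s = w (dn m s) * h s + w' s * y (up m s)" for m s
  have w_cont: "continuous_on {t..T} w"
    using w_deriv by (meson DERIV_isCont continuous_at_imp_continuous_on)
  have "bounded (w ` {t..T})"
    by (intro compact_imp_bounded compact_continuous_image w_cont compact_Icc)
  then obtain D where D: "\<And>s. s \<in> {t..T} \<Longrightarrow> \<bar>w s\<bar> \<le> D"
    unfolding bounded_iff by (metis image_eqI real_norm_def)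
  have "bounded (w' ` {t..T})"
    by (intro compact_imp_bounded compact_continuous_image w'_cont compact_Icc)
  then obtain D' where D': "\<And>s. s \<in> {t..T} \<Longrightarrow> \<bar>w' s\<bar> \<le> D'"
    unfolding bounded_iff by (metis image_eqI real_norm_def)
  have "0 \<le> C" using y_bound[of t] \<open>t < T\<close> by auto
  have "0 \<le> D" using D[of t] \<open>t < T\<close> by auto
  have "0 \<le> D'" using D'[of t] \<open>t < T\<close> by auto
  have c_meas: "c m \<in> measurable borel (count_space UNIV)" for m unfolding c_def by measurable
  have [measurable]: "up m \<in> borel_measurable borel" "dn m \<in> borel_measurable borel" for m
    unfolding up_def dn_def using c_meas[measurable] by measurable
  have \<Phi>_meas[measurable]: "\<Phi> m \<in> borel_measurable borel" for m
    unfolding \<Phi>_def by measurable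
  have up_ge: "s \<le> up m s" and dn_le: "dn m s \<le> s" if "s \<in> {t..T}" "m > 0" for s m
  proof -
    let ?c = "real_of_int (c m s)"
    have 1: "(s - t) * real m / (T - t) \<le> ?c" "?c \<le> (s - t) * real m / (T - t) + 1" 
      unfolding c_def by linarith+
    have 2: "(s - t) * real m \<le> (T - t) * ?c" "(T - t) * ?c \<le> (s - t) * real m + (T - t)"
      using 1 \<open>t < T\<close> by (simp_all add: field_simps)
    have "s - t \<le> (T - t) * ?c / real m" "(T - t) * (?c - 1) / real m \<le> s - t"
      using 2 that by (simp_all add: field_simps)
    then show "s \<le> up m s" "dn m s \<le> s"
      using that by (auto simp: up_def dn_def)
  qed
  have up_in: "up m s \<in> {t..T}" and dn_in: "dn m s \<in> {t..T}" if "s \<in> {t..T}" "m > 0" for s m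
    using up_ge[OF that] dn_le[OF that] that by (auto simp: up_def dn_def)
  have \<Phi>_bound: "\<bar>\<Phi> m s\<bar> \<le> D * C + D' * C" if "s \<in> {t..T}" "m > 0" for s m
    unfolding \<Phi>_def
    by (rule order_trans[OF abs_triangle_ineq], unfold abs_mult, intro add_mono mult_mono)
       (use D D' y_bound h_bound up_in dn_in that \<open>0 \<le> C\<close> \<open>0 \<le> D\<close> \<open>0 \<le> D'\<close> in auto)
  have \<sigma>_in: "t \<le> \<sigma> m k" "\<sigma> m k \<le> T" if "k \<le> m" for m k
  proof -
    have "real k / real m \<le> 1" using that by (simp add: divide_le_eq)
    then have "(T - t) * (real k / real m) \<le> (T - t) * 1"
      using \<open>t < T\<close> by (intro mult_left_mono) auto
    then show "t \<le> \<sigma> m k" "\<sigma> m k \<le> T" using \<open>t < T\<close> by (auto simp: \<sigma>_def)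
  qed
  have \<sigma>_le: "\<sigma> m k \<le> \<sigma> m (Suc k)" for m k
    using \<open>t < T\<close> by (auto simp: \<sigma>_def divide_right_mono mult_left_mono)
  have \<Phi>_int: "\<Phi> m integrable_on {u..v}" if "m > 0" "t \<le> u" "v \<le> T" for m u v
    by (rule bounded_measurable_integrable_on[OF \<Phi>_meas, where C = "D * C + D' * C"]) (use \<Phi>_bound that in auto)
  have h_int: "h integrable_on {u..v}" if "t \<le> u" "v \<le> T" for u v
    by (rule bounded_measurable_integrable_on[where C = C]) (use h_bound that in auto)
  have w'_int: "(w' has_integral (w v - w u)) {u..v}" if "t \<le> u" "u \<le> v" "v \<le> T" for u v
    by (rule fundamental_theorem_of_calculus)
       (use that w_deriv in \<open>auto intro: has_field_derivative_at_within
          simp: has_real_derivative_iff_has_vector_derivative[symmetric]\<close>)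
  have piece: "integral {\<sigma> m k..\<sigma> m (Suc k)} (\<Phi> m) =
      w (\<sigma> m k) * integral {\<sigma> m k..\<sigma> m (Suc k)} h + (w (\<sigma> m (Suc k)) - w (\<sigma> m k)) * y (\<sigma> m (Suc k))"
    if "k < m" for m k
  proof -
    have "m > 0" using that by simp
    have c_eq: "c m s = int (Suc k)" if "s \<in> {\<sigma> m k<..\<sigma> m (Suc k)}" for s
    proof -
      have "(T - t) * real k / real m < s - t" "s - t \<le> (T - t) * real (Suc k) / real m"
        using that unfolding \<sigma>_def by auto
      then have "(T - t) * real k < (s - t) * real m" "(s - t) * real m \<le> (T - t) * real (Suc k)"
        using \<open>m > 0\<close> by (simp_all add: field_simps)
      then have "real k < (s - t) * real m / (T - t)" "(s - t) * real m / (T - t) \<le> real (Suc k)"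
        using \<open>t < T\<close> by (simp_all add: field_simps)
      then show ?thesis unfolding c_def by (simp add: ceiling_eq_iff)
    qed
    \<comment> \<open>The left end point is outside the half-open cell where \<open>c_eq\<close>
      applies; a single point does not affect the integral.\<close>
    have "integral {\<sigma> m k..\<sigma> m (Suc k)} (\<Phi> m) =
        integral {\<sigma> m k..\<sigma> m (Suc k)} (\<lambda>s. w (\<sigma> m k) * h s + w' s * y (\<sigma> m (Suc k)))"
    proof (rule integral_spike[of "{\<sigma> m k}"])
      fix s assume "s \<in> {\<sigma> m k..\<sigma> m (Suc k)} - {\<sigma> m k}"
      then have "c m s = int (Suc k)" by (intro c_eq) auto
      then have "up m s = \<sigma> m (Suc k)" "dn m s = \<sigma> m k"
        using \<sigma>_in[of "Suc k" m] \<sigma>_in[of k m] that by (auto simp: up_def dn_def \<sigma>_def)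
      then show "w (\<sigma> m k) * h s + w' s * y (\<sigma> m (Suc k)) = \<Phi> m s" by (simp add: \<Phi>_def)
    qed simp
    also have "\<dots> = w (\<sigma> m k) * integral {\<sigma> m k..\<sigma> m (Suc k)} h +
        (w (\<sigma> m (Suc k)) - w (\<sigma> m k)) * y (\<sigma> m (Suc k))"
    proof -
      have "(h has_integral integral {\<sigma> m k..\<sigma> m (Suc k)} h) {\<sigma> m k..\<sigma> m (Suc k)}"
        using h_int \<sigma>_in that by (intro integrable_integral) auto
      from has_integral_add[OF has_integral_mult_right[OF this, of "w (\<sigma> m k)"]
          has_integral_mult_left[OF w'_int, of "\<sigma> m k" "\<sigma> m (Suc k)" "y (\<sigma> m (Suc k))"]]
      show ?thesis using \<sigma>_in[of k m] \<sigma>_in[of "Suc k" m] \<sigma>_le[of m k] that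
        by (intro integral_unique) auto
    qed
    finally show ?thesis .
  qed
  have partial: "j \<le> m \<Longrightarrow> m > 0 \<Longrightarrow> integral {t..\<sigma> m j} (\<Phi> m) = (\<Sum>k<j.
      w (\<sigma> m k) * integral {\<sigma> m k..\<sigma> m (Suc k)} h + (w (\<sigma> m (Suc k)) - w (\<sigma> m k)) * y (\<sigma> m (Suc k)))"
    for j m
  proof (induction j)
    case 0
    then show ?case by (simp add: \<sigma>_def)
  next
    case (Suc j)
    have "integral {t..\<sigma> m j} (\<Phi> m) + integral {\<sigma> m j..\<sigma> m (Suc j)} (\<Phi> m) =
        integral {t..\<sigma> m (Suc j)} (\<Phi> m)"
      using Suc.prems \<sigma>_in[of j m] \<sigma>_in[of "Suc j" m] \<sigma>_le[of m j] \<Phi>_int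
      by (intro Henstock_Kurzweil_Integration.integral_combine) auto
    then show ?case using Suc piece[of j m] by simp
  qed
  have sum_eq: "(\<Sum>k<m. w (\<sigma> m k) * (b (\<sigma> m (Suc k)) - b (\<sigma> m k))) =
      w T * y T - w t * y t - integral {t..T} (\<Phi> m)" if "m > 0" for m
  proof -
    have "(\<Sum>k<m. w (\<sigma> m k) * (b (\<sigma> m (Suc k)) - b (\<sigma> m k))) =
      (\<Sum>k<m. (w (\<sigma> m (Suc k)) * y (\<sigma> m (Suc k)) - w (\<sigma> m k) * y (\<sigma> m k)) -
        (w (\<sigma> m k) * integral {\<sigma> m k..\<sigma> m (Suc k)} h + (w (\<sigma> m (Suc k)) - w (\<sigma> m k)) * y (\<sigma> m (Suc k))))"
    proof (rule sum.cong)
      fix k assume "k \<in> {..<m}"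
      then have *: "b (\<sigma> m (Suc k)) - b (\<sigma> m k) =
          y (\<sigma> m (Suc k)) - y (\<sigma> m k) - integral {\<sigma> m k..\<sigma> m (Suc k)} h"
        using increment[of "\<sigma> m k" "\<sigma> m (Suc k)"] \<sigma>_in[of k m] \<sigma>_in[of "Suc k" m] \<sigma>_le[of m k]
        by simp
      show "w (\<sigma> m k) * (b (\<sigma> m (Suc k)) - b (\<sigma> m k)) =
        (w (\<sigma> m (Suc k)) * y (\<sigma> m (Suc k)) - w (\<sigma> m k) * y (\<sigma> m k)) -
        (w (\<sigma> m k) * integral {\<sigma> m k..\<sigma> m (Suc k)} h + (w (\<sigma> m (Suc k)) - w (\<sigma> m k)) * y (\<sigma> m (Suc k)))"
        unfolding * by algebra
    qed simp
    also have "\<dots> = (w (\<sigma> m m) * y (\<sigma> m m) - w (\<sigma> m 0) * y (\<sigma> m 0)) - integral {t..\<sigma> m m} (\<Phi> m)"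
      using partial[of m m] sum_lessThan_telescope[of "\<lambda>k. w (\<sigma> m k) * y (\<sigma> m k)" m] that
      by (simp add: sum_subtractf)
    finally show ?thesis using that by (simp add: \<sigma>_def)
  qed
  have lim: "(\<lambda>m. \<Phi> (Suc m) s) \<longlonglongrightarrow> w s * h s + w' s * y s" if s: "s \<in> {t..T}" for s
  proof -
    have g: "(\<lambda>m. (T - t) * real_of_int (c m s) / real m) \<longlonglongrightarrow> s - t"
      "(\<lambda>m. (T - t) * (real_of_int (c m s) - 1) / real m) \<longlonglongrightarrow> s - t"
      unfolding c_def using ceiling_grid_tendsto[of "T - t" "s - t"] \<open>t < T\<close> by simp_all
    have "(\<lambda>m. min T (t + (T - t) * real_of_int (c m s) / real m)) \<longlonglongrightarrow> min T (t + (s - t))"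
      by (intro tendsto_intros g)
    then have up: "(\<lambda>m. up (Suc m) s) \<longlonglongrightarrow> s"
      using s unfolding up_def[symmetric] by (intro LIMSEQ_Suc) simp
    have "(\<lambda>m. max t (t + (T - t) * (real_of_int (c m s) - 1) / real m)) \<longlonglongrightarrow> max t (t + (s - t))"
      by (intro tendsto_intros g)
    then have dn: "(\<lambda>m. dn (Suc m) s) \<longlonglongrightarrow> s"
      using s unfolding dn_def[symmetric] by (intro LIMSEQ_Suc) simp
    have "(\<lambda>m. y (up (Suc m) s)) \<longlonglongrightarrow> y s"
    \<comment> \<open>Right-continuity is assumed only before T; at T itself the sampling point is
      constantly T.\<close>
    proof (cases "s = T")
      case True
      then have "up (Suc m) s = T" for m
        using up_ge[of s "Suc m"] s by (auto simp: up_def)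
      then show ?thesis using True by simp
    next
      case False
      then show ?thesis
        using right_continuous_seq[OF y_right[of s], of "\<lambda>m. up (Suc m) s"] s up up_ge by auto
    qed
    moreover have "(\<lambda>m. w (dn (Suc m) s)) \<longlonglongrightarrow> w s"
      using DERIV_isCont[OF w_deriv[OF s]] dn by (rule isCont_tendsto_compose)
    ultimately show ?thesis unfolding \<Phi>_def by (intro tendsto_intros)
  qed
  \<comment> \<open>The index is shifted because the bounds on \<open>\<Phi> m\<close> and the sum
    identity hold only for m > 0; the last step removes the shift.\<close>
  have "(\<lambda>m. integral {t..T} (\<Phi> (Suc m))) \<longlonglongrightarrow> integral {t..T} (\<lambda>s. w s * h s + w' s * y s)"
    by (rule dominated_convergence(2)[where h = "\<lambda>_. D * C + D' * C"])
       (use \<Phi>_int \<Phi>_bound lim in auto)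
  then have "(\<lambda>m. w T * y T - w t * y t - integral {t..T} (\<Phi> (Suc m))) \<longlonglongrightarrow>
      w T * y T - w t * y t - integral {t..T} (\<lambda>s. w s * h s + w' s * y s)"
    by (intro tendsto_intros)
  then have "(\<lambda>m. \<Sum>k<Suc m. w (\<sigma> (Suc m) k) * (b (\<sigma> (Suc m) (Suc k)) - b (\<sigma> (Suc m) k))) \<longlonglongrightarrow>
      w T * y T - w t * y t - integral {t..T} (\<lambda>s. w s * h s + w' s * y s)"
    by (subst sum_eq) simp_all
  then have "(\<lambda>m. \<Sum>k<m. w (\<sigma> m k) * (b (\<sigma> m (Suc k)) - b (\<sigma> m k))) \<longlonglongrightarrow>
      w T * y T - w t * y t - integral {t..T} (\<lambda>s. w s * h s + w' s * y s)"
    by (rule LIMSEQ_imp_Suc)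
  then show ?thesis unfolding \<sigma>_def .
qed

section \<open>The drift near the deterministic solution\<close>

text \<open>Concavity puts the power below its tangent at 1 (weighted mean inequality). For the
  lower bound, ln z <= z - 1 and exp v >= 1 + v bound z^(\<beta>-1) from below, and multiplying by z
  leaves a quadratic defect. Unlike a local Taylor estimate, this holds for every z > 0.\<close>

lemma powr_sub_linear_bounds:
  fixes \<beta> z :: real
  assumes "0 < \<beta>" "\<beta> < 1" "0 < z"
  shows "z powr \<beta> - 1 - \<beta> * (z - 1) \<le> 0" "- ((z - 1)\<^sup>2) \<le> z powr \<beta> - 1 - \<beta> * (z - 1)"
proof -
  show "z powr \<beta> - 1 - \<beta> * (z - 1) \<le> 0"
    using Youngs_inequality_0[of \<beta> "1 - \<beta>" z 1] assms by (simp add: algebra_simps)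
  have "(\<beta> - 1) * (z - 1) \<le> (\<beta> - 1) * ln z"
    using ln_le_minus_one[OF assms(3)] assms(2) by (intro mult_left_mono_neg) auto
  also have "1 + \<dots> \<le> exp ((\<beta> - 1) * ln z)" by (rule exp_ge_add_one_self)
  also have "\<dots> = z powr (\<beta> - 1)" using assms(3) by (simp add: powr_def)
  finally have "z * (1 + (\<beta> - 1) * (z - 1)) \<le> z * z powr (\<beta> - 1)"
    using assms(3) by (intro mult_left_mono) auto
  also have "z * z powr (\<beta> - 1) = z powr \<beta>"
    using assms(3) by (simp add: powr_mult_base)
  finally have "z * (1 + (\<beta> - 1) * (z - 1)) \<le> z powr \<beta>" .
  moreover have "z * (1 + (\<beta> - 1) * (z - 1)) = 1 + \<beta> * (z - 1) - (1 - \<beta>) * (z - 1)\<^sup>2"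
    by (simp add: power2_eq_square algebra_simps)
  moreover have "(1 - \<beta>) * (z - 1)\<^sup>2 \<le> (z - 1)\<^sup>2"
    using assms(1) mult_right_mono[of "1 - \<beta>" 1 "(z - 1)\<^sup>2"] by simp
  ultimately show "- ((z - 1)\<^sup>2) \<le> z powr \<beta> - 1 - \<beta> * (z - 1)" by linarith
qed

text \<open>For an exponent in (0,1) the power lies between 1 and z.\<close>

lemma abs_powr_minus_one_le:
  fixes \<beta> z :: real
  assumes "0 < \<beta>" "\<beta> < 1" "0 < z"
  shows "\<bar>z powr \<beta> - 1\<bar> \<le> \<bar>z - 1\<bar>"
proof (cases "z \<ge> 1")
  case True
  then have "z powr \<beta> \<le> z powr 1" "1 \<le> z powr \<beta>"
    using assms by (intro powr_mono ge_one_powr_ge_zero; simp)+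
  then show ?thesis using True by simp
next
  case False
  then have "z powr 1 \<le> z powr \<beta>" "z powr \<beta> \<le> 1"
    using assms by (intro powr_mono' powr_le1; simp)+
  then show ?thesis using False assms by simp
qed

text \<open>The absolute value serves the exponents \<open>\<kappa>\<close> and 1/\<alpha> - 1 met
  later, whose sign depends on whether \<alpha> is below or above 1.\<close>

lemma powr_le_of_ratio:
  fixes k z :: real
  assumes "1 / 2 \<le> z" "z \<le> 2"
  shows "z powr k \<le> 2 powr \<bar>k\<bar>"
proof (cases "k \<ge> 0")
  case True
  then show ?thesis using assms by (auto intro: powr_mono2)
next
  case False
  then have "z powr k \<le> (1/2) powr k" using assms by (intro powr_mono2') auto
  also have "\<dots> = 2 powr \<bar>k\<bar>" using False by (simp add: powr_divide powr_minus_divide)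
  finally show ?thesis .
qed

text \<open>Apply \<open>step\<close> to the supremum S itself: S <= A + S/2 gives S <= 2A. The a
  priori bound C serves only to make S finite; its size does not enter the conclusion.\<close>

lemma absorb_bound:
  fixes y :: "real \<Rightarrow> real"
  assumes "I \<noteq> {}" and bound: "\<And>s. s \<in> I \<Longrightarrow> \<bar>y s\<bar> \<le> C"
    and step: "\<And>S s. (\<And>v. v \<in> I \<Longrightarrow> \<bar>y v\<bar> \<le> S) \<Longrightarrow> s \<in> I \<Longrightarrow> \<bar>y s\<bar> \<le> A + S / 2"
    and "s \<in> I"
  shows "\<bar>y s\<bar> \<le> 2 * A"
proof -
  define S where "S = (SUP s\<in>I. \<bar>y s\<bar>)"
  have "bdd_above ((\<lambda>s. \<bar>y s\<bar>) ` I)" using bound by (auto intro!: bdd_aboveI)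
  then have le: "\<bar>y v\<bar> \<le> S" if "v \<in> I" for v
    using that unfolding S_def by (rule cSUP_upper[rotated])
  have "S \<le> A + S / 2"
    unfolding S_def by (rule cSUP_least[OF assms(1)]) (use step le in \<open>auto simp: S_def\<close>)
  then show ?thesis using le[OF assms(4)] by linarith
qed

section \<open>The deterministic solution g and the drift compared with it\<close>

locale power_drift =
  fixes \<alpha> \<beta> a :: real and f :: "real \<Rightarrow> real"
  assumes \<alpha>_pos: "0 < \<alpha>" and a_pos: "0 < a"
    and \<beta>_gt: "1 / (1 + \<alpha>) < \<beta>" and \<beta>_less: "\<beta> < 1"
    and f_cont: "continuous_on UNIV f"
    and f_asymp: "(\<lambda>x. f x - a * x powr \<beta>) \<in> o[at_top](\<lambda>x. x powr (\<beta> - (\<alpha> + \<beta> - 1) / \<alpha>))"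
begin

definition "p = 1 / (1 - \<beta>)"
text \<open>\<open>\<gamma> / s\<close> is the slope a \<beta> g(s)^(\<beta>-1) of the power drift
  at g(s), so solutions of the linearised equation grow like s^\<gamma>.\<close>

definition "\<gamma> = \<beta> / (1 - \<beta>)"
definition "c1 = (a * (1 - \<beta>)) powr (1 / (1 - \<beta>))"
definition "g s = c1 * s powr p"
text \<open>
  The choice \<open>p * (ratio - 1) = 1 / 4\<close> lets the a priori bounds on \<open>[t, ratio * t]\<close> absorb the
  linear term of the drift directly, which replaces Gronwall's inequality.
\<close>

definition "ratio = 1 + 1 / (4 * p)"

lemma \<beta>_pos: "0 < \<beta>"
  using \<beta>_gt \<alpha>_pos by (smt (verit) divide_pos_pos)

lemma p_gt_1: "1 < p"
  using \<beta>_pos \<beta>_less by (simp add: p_def)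

lemma \<gamma>_eq: "\<gamma> = p - 1" "\<gamma> = \<beta> * p"
  using \<beta>_less by (auto simp: \<gamma>_def p_def field_simps)

lemma \<gamma>_gt: "1 / \<alpha> < \<gamma>"
proof -
  have "1 < \<beta> * (1 + \<alpha>)" using \<beta>_gt \<alpha>_pos by (simp add: divide_less_eq)
  then show ?thesis using \<beta>_less \<alpha>_pos by (simp add: \<gamma>_def field_simps)
qed

lemma ratio_bounds: "1 < ratio" "ratio \<le> 2" "p * (ratio - 1) = 1 / 4"
  using p_gt_1 by (auto simp: ratio_def divide_le_eq)

lemma c1_pos: "0 < c1"
  using a_pos \<beta>_less by (simp add: c1_def)

lemma g_pos: "0 < s \<Longrightarrow> 0 < g s"
  using c1_pos by (simp add: g_def)

text \<open>The constant satisfies c1^(1-\<beta>) = a / p, which matches coefficients, and p \<beta>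
  = p - 1 matches the powers of s.\<close>

lemma drift_g:
  assumes "0 < s"
  shows "a * g s powr \<beta> = p * g s / s"
proof -
  have "c1 powr (1 - \<beta>) = a * (1 - \<beta>)"
    using a_pos \<beta>_less by (simp add: c1_def powr_powr)
  then have "a * (1 - \<beta>) * c1 powr \<beta> = c1"
    using c1_pos by (metis diff_add_cancel powr_add powr_one less_imp_le)
  then have 1: "a * c1 powr \<beta> = p * c1"
    using \<beta>_less by (simp add: p_def field_simps)
  have "s powr (p * \<beta>) = s powr p / s"
    using assms \<gamma>_eq by (metis mult.commute powr_diff powr_one less_imp_le)
  then show ?thesis
    using 1 assms c1_pos by (simp add: g_def powr_mult powr_powr)
qed

lemma g_deriv:
  assumes "0 < s"
  shows "(g has_real_derivative a * g s powr \<beta>) (at s)"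
proof -
  have "(g has_real_derivative c1 * (p * s powr (p - 1))) (at s)"
    unfolding g_def[abs_def] by (rule DERIV_cmult has_real_derivative_powr assms)+
  moreover have "c1 * (p * s powr (p - 1)) = a * g s powr \<beta>"
    unfolding drift_g[OF assms] using assms by (simp add: g_def powr_diff)
  ultimately show ?thesis by simp
qed

text \<open>Dividing by g(s) reduces the claim to the scalar inequality for q = z / g(s). The slope
  is p/s rather than the local \<gamma>/s because z may be any positive number; this is what can be
  used before X is known to be close to g.\<close>

lemma drift_lipschitz:
  assumes "0 < s" "0 < z"
  shows "\<bar>a * z powr \<beta> - a * g s powr \<beta>\<bar> \<le> p / s * \<bar>z - g s\<bar>"
proof -
  let ?q = "z / g s"
  note gs = g_pos[OF assms(1)]
  have q: "0 < ?q" using gs assms by simp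
  have z: "z powr \<beta> = g s powr \<beta> * ?q powr \<beta>"
    using gs assms by (simp add: powr_divide)
  have "a * z powr \<beta> - a * g s powr \<beta> = (a * g s powr \<beta>) * (?q powr \<beta> - 1)"
    unfolding z by (simp add: algebra_simps)
  also have "\<bar>\<dots>\<bar> = p * g s / s * \<bar>?q powr \<beta> - 1\<bar>"
    unfolding drift_g[OF assms(1)] using gs p_gt_1 assms by (simp add: abs_mult)
  also have "\<dots> \<le> p * g s / s * \<bar>?q - 1\<bar>"
    using gs p_gt_1 assms by (intro mult_left_mono abs_powr_minus_one_le \<beta>_pos \<beta>_less q) auto
  also have "\<dots> = p / s * (g s * \<bar>?q - 1\<bar>)" by simp
  also have "g s * \<bar>?q - 1\<bar> = \<bar>g s * (?q - 1)\<bar>" using gs by (simp add: abs_mult)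
  also have "g s * (?q - 1) = z - g s" using gs by (simp add: field_simps)
  finally show ?thesis .
qed

text \<open>The same rescaling by g(s), now with the second-order scalar bound: the relative error
  is quadratic in the relative deviation from g.\<close>

lemma drift_linearization:
  assumes "0 < s" "0 < z"
  shows "\<bar>a * z powr \<beta> - a * g s powr \<beta> - \<gamma> / s * (z - g s)\<bar> \<le> p * (z - g s)\<^sup>2 / (s * g s)"
proof -
  let ?q = "z / g s"
  note gs = g_pos[OF assms(1)]
  have q: "0 < ?q" using gs assms by simp
  have z: "z powr \<beta> = g s powr \<beta> * ?q powr \<beta>"
    using gs assms by (simp add: powr_divide)
  have zq: "z - g s = g s * (?q - 1)" using gs by (simp add: field_simps)
  have "a * z powr \<beta> - a * g s powr \<beta> - \<gamma> / s * (z - g s) =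
      (a * g s powr \<beta>) * (?q powr \<beta> - 1) - \<gamma> / s * (g s * (?q - 1))"
    unfolding z zq[symmetric] by (simp add: algebra_simps)
  also have "\<dots> = p * g s / s * (?q powr \<beta> - 1 - \<beta> * (?q - 1))"
    unfolding drift_g[OF assms(1)] \<gamma>_eq(2) by (simp add: algebra_simps)
  also have "\<bar>\<dots>\<bar> = p * g s / s * \<bar>?q powr \<beta> - 1 - \<beta> * (?q - 1)\<bar>"
    using gs p_gt_1 assms by (simp add: abs_mult)
  also have "\<dots> \<le> p * g s / s * (?q - 1)\<^sup>2"
    using gs p_gt_1 assms powr_sub_linear_bounds[OF \<beta>_pos \<beta>_less q]
    by (intro mult_left_mono) auto
  also have "\<dots> = p * (g s * (?q - 1))\<^sup>2 / (s * g s)"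
    using gs assms by (simp add: power2_eq_square field_simps)
  finally show ?thesis unfolding zq[symmetric] .
qed

text \<open>This explains the value of r: along g, of order s^p, the admissible error x^(\<beta>-r)
  becomes s^(1/\<alpha>-1), the rate at which the normalisation s^(1/\<alpha>) itself grows.\<close>

lemma exponent_eq: "p * (\<beta> - (\<alpha> + \<beta> - 1) / \<alpha>) = 1 / \<alpha> - 1"
  using \<alpha>_pos \<beta>_less by (simp add: p_def field_simps)

lemma g_powr_exponent:
  assumes "0 < s"
  shows "g s powr (\<beta> - (\<alpha> + \<beta> - 1) / \<alpha>) =
    c1 powr (\<beta> - (\<alpha> + \<beta> - 1) / \<alpha>) * s powr (1 / \<alpha> - 1)"
  using assms c1_pos by (simp add: g_def powr_mult powr_powr exponent_eq)

text \<open>Positivity of r makes x^(\<beta>-r) at most x^\<beta> for x >= 1, the only comparison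
  available before X is known to be comparable with g.\<close>

lemma r_pos: "0 < (\<alpha> + \<beta> - 1) / \<alpha>"
proof -
  have "1 < \<beta> * (1 + \<alpha>)" using \<beta>_gt \<alpha>_pos by (simp add: divide_less_eq)
  also have "\<beta> * (1 + \<alpha>) < \<beta> + \<alpha>" using \<beta>_less \<alpha>_pos by (simp add: algebra_simps)
  finally show ?thesis using \<alpha>_pos by simp
qed

end

section \<open>Pathwise linearisation\<close>

lemma abs_integral_le:
  fixes h :: "real \<Rightarrow> real"
  assumes "u \<le> v" "h integrable_on {u..v}" "\<And>s. s \<in> {u..v} \<Longrightarrow> \<bar>h s\<bar> \<le> C"
  shows "\<bar>integral {u..v} h\<bar> \<le> C * (v - u)"
proof -
  have "0 \<le> C" using assms(3)[of u] assms(1) by force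
  from has_integral_bound_real[OF this finite.emptyI integrable_integral[OF assms(2)]] assms show ?thesis by auto
qed

text \<open>One deterministic path: x and b stand for a trajectory of the solution and of the noise.
  Probability enters only after the estimates for such a path are complete.\<close>

locale power_drift_path = power_drift +
  fixes x b :: "real \<Rightarrow> real"
  assumes x_cadlag: "cadlag x" and b_cadlag: "cadlag b"
    and solution: "\<And>t. 0 \<le> t \<Longrightarrow> x t = x 0 + (LBINT s:{0..t}. f (x s)) + b t"
    and x_top: "filterlim x at_top at_top"
begin

definition "y s = x s - g s"
definition "h s = f (x s) - a * g s powr \<beta>"
definition "err s = h s - \<gamma> / s * y s"
text \<open>The factor s^(-\<gamma>) is the integrating factor of the linearised equation, and
  \<open>err\<close> is what the linearisation leaves of the drift. The prefactor is the one that
  turns t^(-\<gamma>) y(t) into y(t) / t^(1/\<alpha>).\<close>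

definition "remainder t = t powr (\<gamma> - 1 / \<alpha>) * integral {t..ratio * t} (\<lambda>s. s powr (-\<gamma>) * err s)"

text \<open>\<open>y0\<close> and \<open>h0\<close> are measurable on the whole line; nothing is known about the path at negative times.\<close>

definition "y0 s = x (max 0 s) - g (max 0 s)"
definition "h0 s = f (x (max 0 s)) - a * g (max 0 s) powr \<beta>"

lemma y0_eq: "0 \<le> s \<Longrightarrow> y0 s = y s" and h0_eq: "0 \<le> s \<Longrightarrow> h0 s = h s"
  by (simp_all add: y0_def h0_def y_def h_def max_def)

section \<open>Measurability, boundedness and increments of a fixed path\<close>

lemma f_measurable[measurable]: "f \<in> borel_measurable borel"
  using f_cont by (rule borel_measurable_continuous_onI)

lemma g_measurable[measurable]: "g \<in> borel_measurable borel"
  unfolding g_def[abs_def] by measurable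

lemma x0_measurable[measurable]: "(\<lambda>s. x (max 0 s)) \<in> borel_measurable borel"
  using x_cadlag by (rule cadlag_measurable)

lemma y0_measurable[measurable]: "y0 \<in> borel_measurable borel"
  and h0_measurable[measurable]: "h0 \<in> borel_measurable borel"
proof -
  have [measurable]: "(\<lambda>s. g (max 0 s)) \<in> borel_measurable borel" by measurable
  show "y0 \<in> borel_measurable borel" unfolding y0_def[abs_def] by measurable
  have "(\<lambda>s. f (x (max 0 s))) \<in> borel_measurable borel"
    using measurable_compose[OF x0_measurable f_measurable] .
  then show "h0 \<in> borel_measurable borel" unfolding h0_def[abs_def] by measurable
qed

lemma fx_bounded: "\<exists>C. \<forall>s\<in>{0..T}. \<bar>f (x s)\<bar> \<le> C"
proof -
  obtain C where C: "\<forall>s\<in>{0..T}. \<bar>x s\<bar> \<le> C" using cadlag_bounded[OF x_cadlag] by blast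
  have "compact (f ` {-C..C})"
    by (rule compact_continuous_image[OF continuous_on_subset[OF f_cont] compact_Icc]) auto
  then have "bounded (f ` {-C..C})" by (rule compact_imp_bounded)
  then obtain D where D: "\<And>z. z \<in> {-C..C} \<Longrightarrow> \<bar>f z\<bar> \<le> D"
    unfolding bounded_iff by (metis image_eqI real_norm_def)
  have "\<bar>f (x s)\<bar> \<le> D" if "s \<in> {0..T}" for s
    using C that by (intro D) (auto simp: abs_le_iff minus_le_iff)
  then show ?thesis by blast
qed

lemma g_mono: "0 \<le> s \<Longrightarrow> s \<le> t \<Longrightarrow> g s \<le> g t"
  using c1_pos p_gt_1 by (auto simp: g_def intro!: mult_left_mono powr_mono2)

lemma g_nonneg: "0 \<le> g s"
  using c1_pos by (simp add: g_def)

lemma yh_bounded: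
  assumes "0 \<le> t"
  shows "\<exists>C. \<forall>s\<in>{t..T}. \<bar>y s\<bar> \<le> C \<and> \<bar>h s\<bar> \<le> C"
proof -
  obtain C where C: "\<forall>s\<in>{0..T}. \<bar>x s\<bar> \<le> C" using cadlag_bounded[OF x_cadlag] by blast
  obtain D where D: "\<forall>s\<in>{0..T}. \<bar>f (x s)\<bar> \<le> D" using fx_bounded by blast
  have "\<bar>y s\<bar> \<le> max (C + g T) (D + a * g T powr \<beta>) \<and> \<bar>h s\<bar> \<le> max (C + g T) (D + a * g T powr \<beta>)"
    if s: "s \<in> {t..T}" for s
  proof -
    have "g s \<le> g T" using s assms by (intro g_mono) auto
    moreover have "a * g s powr \<beta> \<le> a * g T powr \<beta>"
      using \<open>g s \<le> g T\<close> a_pos \<beta>_pos g_nonneg by (intro mult_left_mono powr_mono2) auto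
    moreover have "0 \<le> g s" "0 \<le> a * g s powr \<beta>" using a_pos g_nonneg by auto
    moreover have "\<bar>x s\<bar> \<le> C" "\<bar>f (x s)\<bar> \<le> D" using C D s assms by auto
    ultimately show ?thesis unfolding y_def h_def by linarith
  qed
  then show ?thesis by blast
qed

lemma h_integrable:
  assumes "0 \<le> u"
  shows "h integrable_on {u..v}"
proof -
  obtain C where "\<forall>s\<in>{u..v}. \<bar>y s\<bar> \<le> C \<and> \<bar>h s\<bar> \<le> C" using yh_bounded[OF assms] by blast
  then have "h0 integrable_on {u..v}"
    using assms by (intro bounded_measurable_integrable_on[where C = C]) (auto simp: h0_eq)
  then show ?thesis
    by (rule integrable_eq) (use assms in \<open>auto simp: h0_eq\<close>)
qed

text \<open>The integral equation at v minus that at u, less the equation g' = a g^\<beta>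
  integrated over [u, v]. The Lebesgue integral of the equation is rewritten as a gauge integral
  here, the form used by the Stieltjes sums.\<close>

lemma y_increment:
  assumes "0 < u" "u \<le> v"
  shows "y v - y u = integral {u..v} h + (b v - b u)"
proof -
  have si: "set_integrable lborel {0..T} (\<lambda>s. f (x s))" for T
  proof -
    obtain D where D: "\<forall>s\<in>{0..T}. \<bar>f (x s)\<bar> \<le> D" using fx_bounded by blast
    have "set_integrable lborel {0..T} (\<lambda>s. f (x (max 0 s)))"
      using measurable_compose[OF x0_measurable f_measurable] D
      by (intro bounded_measurable_set_integrable[where C = D]) auto
    then show ?thesis
      by (rule set_integrable_cong[THEN iffD1, rotated -1]) auto
  qed
  have int: "(\<lambda>s. f (x s)) integrable_on {0..T}"
    and eq: "(LBINT s:{0..T}. f (x s)) = integral {0..T} (\<lambda>s. f (x s))" for T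
    using set_borel_integral_eq_integral[OF si] by auto
  have "integral {0..u} (\<lambda>s. f (x s)) + integral {u..v} (\<lambda>s. f (x s)) = integral {0..v} (\<lambda>s. f (x s))"
    using assms int by (intro Henstock_Kurzweil_Integration.integral_combine) auto
  then have 1: "x v - x u = integral {u..v} (\<lambda>s. f (x s)) + (b v - b u)"
    using solution[of u] solution[of v] assms by (simp add: eq)
  have 2: "((\<lambda>s. a * g s powr \<beta>) has_integral (g v - g u)) {u..v}"
    by (rule fundamental_theorem_of_calculus)
       (use assms g_deriv in \<open>auto intro: has_field_derivative_at_within
          simp: has_real_derivative_iff_has_vector_derivative[symmetric]\<close>)
  have 3: "(\<lambda>s. f (x s)) integrable_on {u..v}"
    by (rule integrable_on_subinterval[OF int[of v]]) (use assms in auto)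
  have "(h has_integral (integral {u..v} (\<lambda>s. f (x s)) - (g v - g u))) {u..v}"
    unfolding h_def[abs_def] by (rule has_integral_diff[OF integrable_integral[OF 3] 2])
  then have "integral {u..v} h = integral {u..v} (\<lambda>s. f (x s)) - (g v - g u)"
    by (rule integral_unique)
  then show ?thesis using 1 by (simp add: y_def)
qed

lemma g_tendsto:
  assumes "0 < s"
  shows "(g \<longlongrightarrow> g s) (at s within A)"
  using DERIV_isCont[OF g_deriv[OF assms]] unfolding isCont_def by (rule tendsto_within_subset) simp

lemma y_right:
  assumes "0 < s"
  shows "(y0 \<longlongrightarrow> y0 s) (at_right s)"
proof -
  have "(y \<longlongrightarrow> y s) (at_right s)"
    unfolding y_def[abs_def] using x_cadlag assms
    by (intro tendsto_diff g_tendsto) (auto simp: cadlag_def)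
  moreover have "eventually (\<lambda>v. y v = y0 v) (at_right s)"
    using assms by (auto simp: eventually_at_filter y0_eq)
  ultimately show ?thesis using assms by (simp add: y0_eq tendsto_cong)
qed

text \<open>Integration by parts with weight w(s) = s^(-\<gamma>): the term w' y cancels the linear
  part (\<gamma>/s) y of the drift, so w h + w' y = w \<open>err\<close>.\<close>

lemma remainder_limit:
  assumes "0 < t"
  shows "(\<lambda>m. t powr (\<gamma> - 1 / \<alpha>) * ((ratio * t) powr (-\<gamma>) * y (ratio * t) - t powr (-\<gamma>) * y t -
      (\<Sum>k<m. (t + (ratio * t - t) * real k / real m) powr (-\<gamma>) *
         (b (t + (ratio * t - t) * real (Suc k) / real m) - b (t + (ratio * t - t) * real k / real m)))))
    \<longlonglongrightarrow> remainder t"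
proof -
  let ?T = "ratio * t"
  have tT: "t < ?T" using assms ratio_bounds by simp
  obtain C where C: "\<forall>s\<in>{t..?T}. \<bar>y s\<bar> \<le> C \<and> \<bar>h s\<bar> \<le> C"
    using yh_bounded[of t] assms by auto
  have "(\<lambda>m. \<Sum>k<m. (t + (?T - t) * real k / real m) powr (-\<gamma>) *
         (b (t + (?T - t) * real (Suc k) / real m) - b (t + (?T - t) * real k / real m))) \<longlonglongrightarrow>
      ?T powr (-\<gamma>) * y0 ?T - t powr (-\<gamma>) * y0 t -
      integral {t..?T} (\<lambda>s. s powr (-\<gamma>) * h0 s + (-\<gamma> * s powr (-\<gamma> - 1)) * y0 s)"
  proof (rule stieltjes_sums_tendsto[where C = C, OF tT])
    show "((\<lambda>s. s powr (-\<gamma>)) has_real_derivative -\<gamma> * s powr (-\<gamma> - 1)) (at s)"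
      if "s \<in> {t..?T}" for s
      using that assms has_real_derivative_powr[of s "-\<gamma>"] by auto
    show "continuous_on {t..?T} (\<lambda>s. -\<gamma> * s powr (-\<gamma> - 1))"
      using assms by (intro continuous_intros) auto
    show "y0 v - y0 u = integral {u..v} h0 + (b v - b u)" if "t \<le> u" "u \<le> v" for u v
    proof -
      have "integral {u..v} h0 = integral {u..v} h"
        using that assms by (intro integral_cong) (auto simp: h0_eq)
      then show ?thesis using y_increment[of u v] that assms by (simp add: y0_eq)
    qed
  qed (use C assms y_right in \<open>auto simp: y0_eq h0_eq\<close>)
  moreover have "integral {t..?T} (\<lambda>s. s powr (-\<gamma>) * h0 s + (-\<gamma> * s powr (-\<gamma> - 1)) * y0 s) =
      integral {t..?T} (\<lambda>s. s powr (-\<gamma>) * err s)"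
  proof (rule integral_cong)
    fix s assume "s \<in> {t..?T}"
    then have "0 < s" using assms by auto
    then show "s powr (-\<gamma>) * h0 s + (-\<gamma> * s powr (-\<gamma> - 1)) * y0 s = s powr (-\<gamma>) * err s"
      by (simp add: err_def h0_eq y0_eq powr_diff algebra_simps)
  qed
  ultimately have lim: "(\<lambda>m. \<Sum>k<m. (t + (?T - t) * real k / real m) powr (-\<gamma>) *
         (b (t + (?T - t) * real (Suc k) / real m) - b (t + (?T - t) * real k / real m))) \<longlonglongrightarrow>
      ?T powr (-\<gamma>) * y ?T - t powr (-\<gamma>) * y t - integral {t..?T} (\<lambda>s. s powr (-\<gamma>) * err s)"
    using assms tT by (simp add: y0_eq)
  show ?thesis
    unfolding remainder_def
    by (rule tendsto_eq_intros lim refl)+ simp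
qed


text \<open>A bootstrap on [t, ratio t]. The Lipschitz bound first gives |y| <= g(t)/2, so x is
  within a factor 2 of g and the o-term of f is at most a small multiple of t^(1/\<alpha>-1). A
  second absorption then gives |y| = O(t^(1/\<alpha>)), which makes the quadratic error small as
  well. The threshold for t depends on the path through the time after which x stays large.\<close>

lemma remainder_small:
  assumes "0 < K" "0 < \<eta>"
  shows "eventually (\<lambda>t. \<bar>y t\<bar> \<le> K * t powr (1 / \<alpha>) \<longrightarrow>
    (\<forall>s\<in>{0..2 * t}. \<bar>b s\<bar> \<le> K * t powr (1 / \<alpha>)) \<longrightarrow> \<bar>remainder t\<bar> \<le> \<eta>) at_top"
proof -
  define \<kappa> where "\<kappa> = \<beta> - (\<alpha> + \<beta> - 1) / \<alpha>"
  \<comment> \<open>The factors come from replacing x by g(s), from g(s) = c1 s^p, and from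
    replacing s by t, so that \<epsilon> x^\<kappa> <= \<epsilon> C1 t^(1/\<alpha>-1).\<close>
  define C1 where "C1 = c1 powr \<kappa> * 2 powr \<bar>\<kappa>\<bar> * 2 powr \<bar>1 / \<alpha> - 1\<bar>"
  \<comment> \<open>The first entry makes the o-term harmless in the crude bound; the second keeps
    \<epsilon> C1 below both 1, used for \<open>C2\<close>, and \<eta>/2, half of the final
    error.\<close>
  define \<epsilon> where "\<epsilon> = min (a / (2 powr p * 2)) (min 1 (\<eta> / 2) / C1)"
  \<comment> \<open>This is 2 (3K + 1), the outcome of the second absorption below.\<close>
  define C2 where "C2 = 6 * K + 2"
  have C1: "0 < C1" using c1_pos by (simp add: C1_def)
  have \<epsilon>: "0 < \<epsilon>" "\<epsilon> * C1 \<le> 1" "\<epsilon> * C1 \<le> \<eta> / 2" "\<epsilon> / a * 2 powr p \<le> 1 / 2"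
  proof -
    show "0 < \<epsilon>" using C1 assms a_pos by (auto simp: \<epsilon>_def)
    have "\<epsilon> \<le> min 1 (\<eta> / 2) / C1" unfolding \<epsilon>_def by simp
    then have "\<epsilon> * C1 \<le> min 1 (\<eta> / 2)" using C1 by (simp add: pos_le_divide_eq)
    then show "\<epsilon> * C1 \<le> 1" "\<epsilon> * C1 \<le> \<eta> / 2" by auto
    have "\<epsilon> \<le> a / (2 powr p * 2)" unfolding \<epsilon>_def by simp
    then show "\<epsilon> / a * 2 powr p \<le> 1 / 2" using a_pos by (simp add: field_simps)
  qed
  have "\<epsilon> \<le> a"
  proof -
    have "1 \<le> 2 powr p" using p_gt_1 by (intro ge_one_powr_ge_zero) auto
    then have "\<epsilon> / a * 1 \<le> \<epsilon> / a * 2 powr p" using \<epsilon>(1) a_pos by (intro mult_left_mono) auto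
    then show ?thesis using \<epsilon>(4) a_pos by (simp add: field_simps)
  qed
  from landau_o.smallD[OF f_asymp \<epsilon>(1)]
  obtain z0 where z0: "\<And>z. z0 \<le> z \<Longrightarrow> \<bar>f z - a * z powr \<beta>\<bar> \<le> \<epsilon> * z powr \<kappa>"
    unfolding \<kappa>_def eventually_at_top_linorder by auto
  have "eventually (\<lambda>s. max 1 z0 \<le> x s) at_top"
    using x_top unfolding filterlim_at_top by blast
  then obtain t0 where t0: "\<And>s. t0 \<le> s \<Longrightarrow> max 1 z0 \<le> x s"
    unfolding eventually_at_top_linorder by auto
  have p\<alpha>: "1 / \<alpha> < p" using \<gamma>_gt \<gamma>_eq by simp
  have lim: "((\<lambda>t. t powr (1 / \<alpha> - p)) \<longlongrightarrow> 0) at_top"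
    using p\<alpha> by (intro tendsto_neg_powr filterlim_ident) auto
  \<comment> \<open>With t^p = g(t) / c1 this says 6 K t^(1/\<alpha>) <= g(t)/4, as needed for the
    crude bound; \<open>ev2\<close> is the smallness of the quadratic error.\<close>
  have ev1: "eventually (\<lambda>t. t powr (1 / \<alpha> - p) < c1 / (24 * K)) at_top"
    using assms c1_pos by (intro order_tendstoD(2)[OF lim]) auto
  have ev2: "eventually (\<lambda>t. t powr (1 / \<alpha> - p) < \<eta> / 2 * c1 / (p * C2\<^sup>2)) at_top"
    using assms c1_pos p_gt_1 by (intro order_tendstoD(2)[OF lim]) (auto simp: C2_def)
  show ?thesis
    using ev1 ev2 eventually_ge_at_top[of "max 1 t0"]
  proof (eventually_elim, intro impI)
    fix t assume t1: "t powr (1 / \<alpha> - p) < c1 / (24 * K)"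
      and t2: "t powr (1 / \<alpha> - p) < \<eta> / 2 * c1 / (p * C2\<^sup>2)"
      and t_ge: "max 1 t0 \<le> t" and yt: "\<bar>y t\<bar> \<le> K * t powr (1 / \<alpha>)"
      and bt: "\<forall>s\<in>{0..2 * t}. \<bar>b s\<bar> \<le> K * t powr (1 / \<alpha>)"
    have t: "0 < t" using t_ge by auto
    let ?I = "{t..ratio * t}"
    define A0 where "A0 = t powr (1 / \<alpha>)"
    have A0: "0 < A0" using t by (simp add: A0_def)
    have len: "ratio * t - t = (ratio - 1) * t" by (simp add: algebra_simps)
    have ratio_t: "ratio * t \<le> 2 * t" "t \<le> ratio * t" using ratio_bounds t by auto
    have s_pos: "0 < s" and s_le: "s \<le> 2 * t" and s_ge: "t \<le> s" and s_t0: "t0 \<le> s"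
      if "s \<in> ?I" for s
    proof -
      have "t \<le> s" "s \<le> ratio * t" using that by auto
      moreover have "t0 \<le> t" using t_ge by simp
      ultimately show "0 < s" "s \<le> 2 * t" "t \<le> s" "t0 \<le> s" using t ratio_t(1) by linarith+
    qed
    have xs: "1 \<le> x s" and x0: "z0 \<le> x s" if "s \<in> ?I" for s
      using t0[OF s_t0[OF that]] by auto
    obtain C where C: "\<forall>s\<in>?I. \<bar>y s\<bar> \<le> C \<and> \<bar>h s\<bar> \<le> C"
      using yh_bounded[of t] t by auto
    \<comment> \<open>The three multiples of K bound y(t), b(s) and b(t).\<close>
    have y_le: "\<bar>y s\<bar> \<le> 3 * K * A0 + B * ((ratio - 1) * t)"
      if s: "s \<in> ?I" and B: "\<And>v. v \<in> ?I \<Longrightarrow> \<bar>h v\<bar> \<le> B" for s B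
    proof -
      have "0 \<le> B" using B[OF s] by linarith
      have "\<bar>integral {t..s} h\<bar> \<le> B * (s - t)"
        using s t B by (intro abs_integral_le h_integrable) auto
      also have "\<dots> \<le> B * ((ratio - 1) * t)"
        unfolding len[symmetric] using s \<open>0 \<le> B\<close> by (intro mult_left_mono) auto
      finally have "\<bar>integral {t..s} h\<bar> \<le> B * ((ratio - 1) * t)" .
      moreover have "y s = y t + integral {t..s} h + (b s - b t)"
        using y_increment[of t s] s t by simp
      moreover have "\<bar>b s\<bar> \<le> K * A0" "\<bar>b t\<bar> \<le> K * A0"
        using bt s_le[OF s] s_pos[OF s] t by (auto simp: A0_def)
      ultimately show ?thesis using yt unfolding A0_def[symmetric] by linarith
    qed
    have main: "\<bar>a * x s powr \<beta> - a * g s powr \<beta>\<bar> \<le> p / t * \<bar>y s\<bar>" if s: "s \<in> ?I" for s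
    proof -
      have "\<bar>a * x s powr \<beta> - a * g s powr \<beta>\<bar> \<le> p / s * \<bar>y s\<bar>"
        using drift_lipschitz[OF s_pos[OF s], of "x s"] xs[OF s] by (simp add: y_def)
      also have "\<dots> \<le> p / t * \<bar>y s\<bar>"
        using s_ge[OF s] t p_gt_1 by (intro mult_right_mono divide_left_mono) auto
      finally show ?thesis .
    qed
    have crude: "\<bar>h s\<bar> \<le> 2 * (p / t * \<bar>y s\<bar>) + p / t * (g t / 2)" if s: "s \<in> ?I" for s
    proof -
      have g_drift: "a * g s powr \<beta> \<le> p / t * (2 powr p * g t)"
      proof -
        have "a * g s powr \<beta> = p * g s / s" using drift_g[OF s_pos[OF s]] .
        also have "\<dots> \<le> p * g s / t"
          using s_ge[OF s] t p_gt_1 g_nonneg by (intro divide_left_mono) auto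
        also have "\<dots> \<le> p * g (2 * t) / t"
          using s_le[OF s] s_pos[OF s] t p_gt_1 by (intro divide_right_mono mult_left_mono g_mono) auto
        also have "g (2 * t) = 2 powr p * g t" using t by (simp add: g_def powr_mult)
        finally show ?thesis by simp
      qed
      have "\<bar>f (x s) - a * x s powr \<beta>\<bar> \<le> \<epsilon> * x s powr \<kappa>" using z0 x0 s by blast
      \<comment> \<open>Nothing relates x(s) to g(s) yet, so the error is measured against the drift
        itself, which \<open>main\<close> controls by y and g.\<close>
      also have "\<dots> \<le> \<epsilon> * x s powr \<beta>"
        using xs[OF s] r_pos \<epsilon> unfolding \<kappa>_def by (intro mult_left_mono powr_mono) auto
      also have "\<dots> = \<epsilon> / a * (a * x s powr \<beta>)" using a_pos by simp
      also have "\<dots> \<le> \<epsilon> / a * (p / t * \<bar>y s\<bar> + a * g s powr \<beta>)"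
        using main[OF s] \<epsilon> a_pos by (intro mult_left_mono) auto
      also have "\<dots> \<le> \<epsilon> / a * (p / t * \<bar>y s\<bar> + p / t * (2 powr p * g t))"
        using \<epsilon> a_pos by (intro mult_left_mono add_left_mono g_drift) auto
      also have "\<dots> = \<epsilon> / a * (p / t * \<bar>y s\<bar>) + (\<epsilon> / a * 2 powr p) * (p / t * g t)"
        by (simp add: algebra_simps)
      also have "\<dots> \<le> 1 * (p / t * \<bar>y s\<bar>) + 1 / 2 * (p / t * g t)"
        using \<epsilon> \<open>\<epsilon> \<le> a\<close> a_pos p_gt_1 t g_nonneg by (intro add_mono mult_right_mono) auto
      finally show ?thesis using main[OF s] unfolding h_def by simp
    qed
    have KA0: "6 * K * A0 \<le> g t / 4"
    proof -
      have "A0 = t powr (1 / \<alpha> - p) * t powr p" using t by (simp add: A0_def powr_add[symmetric])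
      also have "\<dots> \<le> c1 / (24 * K) * t powr p" using t1 by (intro mult_right_mono) auto
      finally show ?thesis using assms by (simp add: g_def field_simps)
    qed
    have y_half: "\<bar>y s\<bar> \<le> g t / 2" if "s \<in> ?I" for s
    proof -
      have "\<bar>y s\<bar> \<le> 2 * (3 * K * A0 + g t / 8)"
      \<comment> \<open>The slope 2p/t over a window of length (ratio - 1) t contributes exactly
        S/2, since p (ratio - 1) = 1/4; this fixes the value of \<open>ratio\<close>.\<close>
      proof (rule absorb_bound[of ?I y C])
        fix S v assume S: "\<And>w. w \<in> ?I \<Longrightarrow> \<bar>y w\<bar> \<le> S" and v: "v \<in> ?I"
        have "\<bar>y v\<bar> \<le> 3 * K * A0 + (2 * (p / t * S) + p / t * (g t / 2)) * ((ratio - 1) * t)"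
        proof (rule y_le[OF v])
          fix w assume w: "w \<in> ?I"
          have "2 * (p / t * \<bar>y w\<bar>) \<le> 2 * (p / t * S)"
            using S[OF w] p_gt_1 t by (intro mult_left_mono) auto
          then show "\<bar>h w\<bar> \<le> 2 * (p / t * S) + p / t * (g t / 2)" using crude[OF w] by linarith
        qed
        also have "(2 * (p / t * S) + p / t * (g t / 2)) * ((ratio - 1) * t) =
            (2 * S + g t / 2) * (p * (ratio - 1))" using t by (simp add: field_simps)
        finally show "\<bar>y v\<bar> \<le> 3 * K * A0 + g t / 8 + S / 2"
          unfolding ratio_bounds(3) by (simp add: field_simps)
      qed (use C that in auto)
      then show ?thesis using KA0 by simp
    qed
    have rest: "\<bar>f (x s) - a * x s powr \<beta>\<bar> \<le> \<epsilon> * C1 * (A0 / t)" if s: "s \<in> ?I" for s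
    proof -
      have gs: "0 < g s" using g_pos[OF s_pos[OF s]] .
      have "g t \<le> g s" using t s_ge[OF s] by (intro g_mono) auto
      then have "\<bar>x s - g s\<bar> \<le> g s / 2" using y_half[OF s] by (simp add: y_def)
      then have "g s / 2 \<le> x s" "x s \<le> 2 * g s" using gs by linarith+
      then have q: "1 / 2 \<le> x s / g s" "x s / g s \<le> 2" using gs by (auto simp: field_simps)
      have "\<bar>f (x s) - a * x s powr \<beta>\<bar> \<le> \<epsilon> * x s powr \<kappa>" using z0 x0 s by blast
      also have "x s powr \<kappa> = (x s / g s) powr \<kappa> * g s powr \<kappa>"
        using gs xs[OF s] by (simp add: powr_divide)
      also have "\<epsilon> * \<dots> \<le> \<epsilon> * (2 powr \<bar>\<kappa>\<bar> * g s powr \<kappa>)"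
        using \<epsilon> powr_le_of_ratio[OF q] by (intro mult_left_mono mult_right_mono) auto
      also have "g s powr \<kappa> = c1 powr \<kappa> * s powr (1 / \<alpha> - 1)"
        unfolding \<kappa>_def by (rule g_powr_exponent[OF s_pos[OF s]])
      also have "s powr (1 / \<alpha> - 1) = (s / t) powr (1 / \<alpha> - 1) * t powr (1 / \<alpha> - 1)"
        using t s_pos[OF s] by (simp add: powr_divide)
      also have "\<epsilon> * (2 powr \<bar>\<kappa>\<bar> * (c1 powr \<kappa> * ((s / t) powr (1 / \<alpha> - 1) * t powr (1 / \<alpha> - 1)))) \<le>
          \<epsilon> * (2 powr \<bar>\<kappa>\<bar> * (c1 powr \<kappa> * (2 powr \<bar>1 / \<alpha> - 1\<bar> * t powr (1 / \<alpha> - 1))))"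
        using \<epsilon> t s_ge[OF s] s_le[OF s]
        by (intro mult_left_mono mult_right_mono powr_le_of_ratio) (auto simp: field_simps)
      also have "t powr (1 / \<alpha> - 1) = A0 / t" using t by (simp add: A0_def powr_diff)
      finally show ?thesis by (simp add: C1_def mult_ac)
    qed
    have y_fine: "\<bar>y s\<bar> \<le> C2 * A0" if "s \<in> ?I" for s
    proof -
      have "\<bar>y s\<bar> \<le> 2 * (3 * K * A0 + A0)"
      \<comment> \<open>Now that \<open>rest\<close> bounds the o-term independently of y, the slope
        is only p/t, contributing S/4.\<close>
      proof (rule absorb_bound[of ?I y C])
        fix S v assume S: "\<And>w. w \<in> ?I \<Longrightarrow> \<bar>y w\<bar> \<le> S" and v: "v \<in> ?I"
        have "0 \<le> S" using S[OF v] by linarith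
        have "\<bar>y v\<bar> \<le> 3 * K * A0 + (p / t * S + \<epsilon> * C1 * (A0 / t)) * ((ratio - 1) * t)"
        proof (rule y_le[OF v])
          fix w assume w: "w \<in> ?I"
          have "p / t * \<bar>y w\<bar> \<le> p / t * S"
            using S[OF w] p_gt_1 t by (intro mult_left_mono) auto
          then show "\<bar>h w\<bar> \<le> p / t * S + \<epsilon> * C1 * (A0 / t)"
            using main[OF w] rest[OF w] unfolding h_def by linarith
        qed
        also have "(p / t * S + \<epsilon> * C1 * (A0 / t)) * ((ratio - 1) * t) =
            S * (p * (ratio - 1)) + (\<epsilon> * C1) * (ratio - 1) * A0"
          using t by (simp add: field_simps)
        also have "(\<epsilon> * C1) * (ratio - 1) * A0 \<le> 1 * 1 * A0"
          using \<epsilon> C1 A0 ratio_bounds by (intro mult_right_mono mult_mono) auto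
        finally show "\<bar>y v\<bar> \<le> 3 * K * A0 + A0 + S / 2"
          unfolding ratio_bounds(3) using \<open>0 \<le> S\<close> by linarith
      qed (use C that in auto)
      then show ?thesis by (simp add: C2_def algebra_simps)
    qed
    have err_le: "\<bar>err s\<bar> \<le> \<eta> * (A0 / t)" if s: "s \<in> ?I" for s
    proof -
      have g_le: "0 < g t" "g t \<le> g s" using g_pos[OF t] g_mono[of t s] t s_ge[OF s] by auto
      have quad: "p * C2\<^sup>2 / c1 * t powr (1 / \<alpha> - p) \<le> \<eta> / 2"
      proof -
        have "0 < p * C2\<^sup>2" using p_gt_1 assms by (auto simp: C2_def)
        then have "t powr (1 / \<alpha> - p) * (p * C2\<^sup>2) \<le> \<eta> / 2 * c1"
          using t2 by (simp add: pos_less_divide_eq)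
        then show ?thesis using c1_pos by (simp add: field_simps)
      qed
      have "\<bar>a * x s powr \<beta> - a * g s powr \<beta> - \<gamma> / s * y s\<bar> \<le> p * (y s)\<^sup>2 / (s * g s)"
        using drift_linearization[OF s_pos[OF s], of "x s"] xs[OF s] by (simp add: y_def)
      also have "\<dots> \<le> p * (C2 * A0)\<^sup>2 / (t * g t)"
      proof (rule frac_le)
        have "\<bar>y s\<bar>\<^sup>2 \<le> (C2 * A0)\<^sup>2" using y_fine[OF s] by (intro power_mono) auto
        then show "p * (y s)\<^sup>2 \<le> p * (C2 * A0)\<^sup>2" using p_gt_1 by (intro mult_left_mono) auto
        show "t * g t \<le> s * g s" using g_le s_ge[OF s] t by (intro mult_mono) auto
      qed (use g_le t p_gt_1 in auto)
      also have "\<dots> = (p * C2\<^sup>2 / c1) * (A0 / t powr p) * (A0 / t)"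
        by (simp add: power2_eq_square g_def mult_ac)
      also have "A0 / t powr p = t powr (1 / \<alpha> - p)" by (simp add: A0_def powr_diff)
      also have "p * C2\<^sup>2 / c1 * t powr (1 / \<alpha> - p) * (A0 / t) \<le> \<eta> / 2 * (A0 / t)"
        using A0 t by (intro mult_right_mono quad) auto
      finally have "\<bar>a * x s powr \<beta> - a * g s powr \<beta> - \<gamma> / s * y s\<bar> \<le> \<eta> / 2 * (A0 / t)" .
      moreover have "\<epsilon> * C1 * (A0 / t) \<le> \<eta> / 2 * (A0 / t)"
        using \<epsilon> A0 t by (intro mult_right_mono) auto
      ultimately have "\<bar>err s\<bar> \<le> \<eta> / 2 * (A0 / t) + \<eta> / 2 * (A0 / t)"
        using rest[OF s] unfolding err_def h_def by linarith
      then show ?thesis by (simp add: mult.commute)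
    qed
    have "\<bar>integral ?I (\<lambda>s. s powr (-\<gamma>) * err s)\<bar> \<le> (t powr (-\<gamma>) * (\<eta> * (A0 / t))) * (ratio * t - t)"
    proof (rule abs_integral_le)
      have \<gamma>_pos: "0 < \<gamma>" using \<gamma>_eq p_gt_1 by simp
      show bnd: "\<bar>s powr (-\<gamma>) * err s\<bar> \<le> t powr (-\<gamma>) * (\<eta> * (A0 / t))" if s: "s \<in> ?I" for s
        unfolding abs_mult using err_le[OF s] s_ge[OF s] t \<gamma>_pos
        by (intro mult_mono) (auto intro: powr_mono2')
      \<comment> \<open>Integrability is obtained for the globally measurable \<open>h0\<close> and
        \<open>y0\<close> and transferred, as they agree with h and y on the window.\<close>
      have eq: "s powr (-\<gamma>) * (h0 s - \<gamma> / s * y0 s) = s powr (-\<gamma>) * err s" if "s \<in> ?I" for s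
        using s_pos[OF that] by (simp add: h0_eq y0_eq err_def)
      have "(\<lambda>s. s powr (-\<gamma>) * (h0 s - \<gamma> / s * y0 s)) integrable_on ?I"
      proof (rule bounded_measurable_integrable_on)
        show "(\<lambda>s. s powr (-\<gamma>) * (h0 s - \<gamma> / s * y0 s)) \<in> borel_measurable borel"
          by measurable
        show "\<bar>s powr (-\<gamma>) * (h0 s - \<gamma> / s * y0 s)\<bar> \<le> t powr (-\<gamma>) * (\<eta> * (A0 / t))"
          if "s \<in> ?I" for s
          unfolding eq[OF that] using bnd[OF that] .
      qed
      then show "(\<lambda>s. s powr (-\<gamma>) * err s) integrable_on ?I"
        using eq by (rule integrable_eq)
    qed (rule ratio_t(2))
    also have "\<dots> = t powr (-\<gamma>) * (\<eta> * A0) * (ratio - 1)"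
      unfolding len using t by (simp add: field_simps)
    also have "\<dots> \<le> t powr (-\<gamma>) * (\<eta> * A0) * 1"
      using ratio_bounds A0 assms by (intro mult_left_mono) auto
    finally have "t powr (\<gamma> - 1 / \<alpha>) * \<bar>integral ?I (\<lambda>s. s powr (-\<gamma>) * err s)\<bar> \<le>
        t powr (\<gamma> - 1 / \<alpha>) * (t powr (-\<gamma>) * (\<eta> * A0))"
      by (intro mult_left_mono) auto
    also have "\<dots> = \<eta> * (t powr (\<gamma> - 1 / \<alpha>) * t powr (-\<gamma>) * t powr (1 / \<alpha>))"
      by (simp add: A0_def)
    also have "t powr (\<gamma> - 1 / \<alpha>) * t powr (-\<gamma>) * t powr (1 / \<alpha>) = 1"
      using t by (simp add: powr_add[symmetric])
    finally show "\<bar>remainder t\<bar> \<le> \<eta>" by (simp add: remainder_def abs_mult)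
  qed
qed

end

section \<open>Characteristic functions of Levy increments\<close>

lemma sigma_sets_vimage_subset:
  assumes "f \<in> measurable N S" "space N = \<Omega>"
  shows "sigma_sets \<Omega> {f -` A \<inter> \<Omega> |A. A \<in> sets S} \<subseteq> sets N"
proof -
  have "{f -` A \<inter> \<Omega> |A. A \<in> sets S} \<subseteq> sets N"
    using measurable_sets[OF assms(1)] assms(2) by auto
  from sets.sigma_sets_subset[OF this] show ?thesis using assms(2) by simp
qed

lemma levy_process_measurable:
  assumes "filtration_on M F" "adapted F B" "0 \<le> t"
  shows "B t \<in> borel_measurable M"
  using assms measurable_from_subalg unfolding filtration_on_def adapted_def by blast

lemma char_distr_cmult:
  assumes [measurable]: "Y \<in> borel_measurable M"
  shows "char (distr M borel (\<lambda>\<omega>. c * Y \<omega>)) u = char (distr M borel Y) (u * c)"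
  by (simp add: char_def integral_distr mult.assoc)

text \<open>The \<sigma>-algebras generated by W and by the scaled increment lie inside the two that
  \<open>levy_process\<close> makes independent. W may involve the solution X up to time s, so
  independence from \<open>F s\<close>, not merely from the past of B, is essential.\<close>

lemma levy_increment_char:
  fixes W :: "'a \<Rightarrow> real"
  assumes "prob_space M" "filtration_on M F" "levy_process M F B" "0 \<le> s" "s \<le> t"
    and W: "W \<in> borel_measurable (F s)"
  shows "char (distr M borel (\<lambda>\<omega>. W \<omega> + c * (B t \<omega> - B s \<omega>))) u =
    char (distr M borel W) u * char (distr M borel (B (t - s))) (u * c)"
proof -
  interpret prob_space M by fact
  have sub: "subalgebra M (F s)" using assms(2) by (simp add: filtration_on_def)
  have B[measurable]: "B t \<in> borel_measurable M" "B s \<in> borel_measurable M"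
    using levy_process_measurable[OF assms(2)] assms by (auto simp: levy_process_def)
  let ?D = "\<lambda>\<omega>. B t \<omega> - B s \<omega>"
  let ?V = "vimage_algebra (space M) ?D borel"
  have ind: "indep_set (sets (F s)) (sets ?V)"
    using assms by (simp add: levy_process_def)
  have D: "(\<lambda>\<omega>. c * ?D \<omega>) \<in> borel_measurable ?V"
    by (intro borel_measurable_times borel_measurable_const measurable_vimage_algebra1) auto
  have "indep_var borel W borel (\<lambda>\<omega>. c * ?D \<omega>)"
    unfolding indep_var_eq
  proof (intro conjI)
    show "random_variable borel W" using measurable_from_subalg[OF sub W] .
    show "random_variable borel (\<lambda>\<omega>. c * ?D \<omega>)" by measurable
    have "sigma_sets (space M) {W -` A \<inter> space M |A. A \<in> sets borel} \<subseteq> sets (F s)"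
      by (rule sigma_sets_vimage_subset[OF W]) (use sub in \<open>simp add: subalgebra_def\<close>)
    moreover have "sigma_sets (space M) {(\<lambda>\<omega>. c * ?D \<omega>) -` A \<inter> space M |A. A \<in> sets borel} \<subseteq> sets ?V"
      by (rule sigma_sets_vimage_subset[OF D]) simp
    ultimately show "indep_set (sigma_sets (space M) {W -` A \<inter> space M |A. A \<in> sets borel})
       (sigma_sets (space M) {(\<lambda>\<omega>. c * ?D \<omega>) -` A \<inter> space M |A. A \<in> sets borel})"
      using ind unfolding indep_set_def
      by (elim indep_sets_mono_sets) (auto split: bool.split)
  qed
  then have "char (distr M borel (\<lambda>\<omega>. W \<omega> + c * ?D \<omega>)) u =
      char (distr M borel W) u * char (distr M borel (\<lambda>\<omega>. c * ?D \<omega>)) u"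
    by (rule char_distr_add)
  also have "char (distr M borel (\<lambda>\<omega>. c * ?D \<omega>)) u = char (distr M borel ?D) (u * c)"
    by (rule char_distr_cmult) simp
  also have "distr M borel ?D = distr M borel (B (t - s))"
    using assms by (simp add: levy_process_def)
  finally show ?thesis .
qed

lemma levy_sum_char:
  fixes W :: "'a \<Rightarrow> real" and \<sigma> :: "nat \<Rightarrow> real"
  assumes "prob_space M" "filtration_on M F" "levy_process M F B"
    and "0 \<le> \<sigma> 0" "\<And>k. \<sigma> k \<le> \<sigma> (Suc k)" and W: "W \<in> borel_measurable (F (\<sigma> 0))"
  shows "char (distr M borel (\<lambda>\<omega>. W \<omega> + (\<Sum>k<m. c k * (B (\<sigma> (Suc k)) \<omega> - B (\<sigma> k) \<omega>)))) u =
    char (distr M borel W) u * (\<Prod>k<m. char (distr M borel (B (\<sigma> (Suc k) - \<sigma> k))) (u * c k))"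
proof -
  have mono: "\<sigma> i \<le> \<sigma> j" if "i \<le> j" for i j
    using assms(5) that by (rule lift_Suc_mono_le)
  have nonneg: "0 \<le> \<sigma> k" for k using mono[of 0 k] assms(4) by simp
  interpret filtration "space M" F using assms(2) by (simp add: filtration_on_def)
  have F_mono: "Y \<in> borel_measurable (F t)" if "Y \<in> borel_measurable (F s)" "s \<le> t" for s t and Y :: "'a \<Rightarrow> real"
    using that sets_F_mono[OF that(2)] space_F unfolding measurable_def by auto
  have B: "B s \<in> borel_measurable (F t)" if "0 \<le> s" "s \<le> t" for s t
  proof (rule F_mono[OF _ that(2)])
    show "B s \<in> borel_measurable (F s)"
      using that(1) assms(3) by (simp add: levy_process_def adapted_def)
  qed
  \<comment> \<open>The induction also carries measurability of the partial sum at time \<sigma> m,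
    which makes the next increment independent of it.\<close>
  have "(\<lambda>\<omega>. W \<omega> + (\<Sum>k<m. c k * (B (\<sigma> (Suc k)) \<omega> - B (\<sigma> k) \<omega>))) \<in> borel_measurable (F (\<sigma> m)) \<and>
    char (distr M borel (\<lambda>\<omega>. W \<omega> + (\<Sum>k<m. c k * (B (\<sigma> (Suc k)) \<omega> - B (\<sigma> k) \<omega>)))) u =
    char (distr M borel W) u * (\<Prod>k<m. char (distr M borel (B (\<sigma> (Suc k) - \<sigma> k))) (u * c k))"
  proof (induction m)
    case 0
    then show ?case using W by simp
  next
    case (Suc m)
    let ?W = "\<lambda>\<omega>. W \<omega> + (\<Sum>k<m. c k * (B (\<sigma> (Suc k)) \<omega> - B (\<sigma> k) \<omega>))"
    have eq: "(\<lambda>\<omega>. W \<omega> + (\<Sum>k<Suc m. c k * (B (\<sigma> (Suc k)) \<omega> - B (\<sigma> k) \<omega>))) =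
        (\<lambda>\<omega>. ?W \<omega> + c m * (B (\<sigma> (Suc m)) \<omega> - B (\<sigma> m) \<omega>))"
      by (simp add: algebra_simps)
    have "?W \<in> borel_measurable (F (\<sigma> (Suc m)))"
      using F_mono[OF conjunct1[OF Suc.IH] mono[of m "Suc m"]] by simp
    moreover have "B (\<sigma> (Suc m)) \<in> borel_measurable (F (\<sigma> (Suc m)))"
      "B (\<sigma> m) \<in> borel_measurable (F (\<sigma> (Suc m)))"
      using B[OF nonneg[of "Suc m"] order_refl] B[OF nonneg[of m] mono[of m "Suc m"]] by simp_all
    ultimately have "(\<lambda>\<omega>. ?W \<omega> + c m * (B (\<sigma> (Suc m)) \<omega> - B (\<sigma> m) \<omega>)) \<in> borel_measurable (F (\<sigma> (Suc m)))"
      by measurable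
    moreover have "char (distr M borel (\<lambda>\<omega>. ?W \<omega> + c m * (B (\<sigma> (Suc m)) \<omega> - B (\<sigma> m) \<omega>))) u =
        char (distr M borel ?W) u * char (distr M borel (B (\<sigma> (Suc m) - \<sigma> m))) (u * c m)"
      using levy_increment_char[OF assms(1-3) nonneg[of m] mono[of m "Suc m"] conjunct1[OF Suc.IH]]
      by simp
    ultimately show ?case unfolding eq using Suc by simp
  qed
  then show ?thesis by blast
qed

section \<open>Decay of the stable characteristic function\<close>

lemma sets_stable_levy_measure[measurable_cong]:
  "sets (stable_levy_measure \<alpha> c_pos c_neg) = sets borel"
  by (simp add: stable_levy_measure_def)

text \<open>For 0 < |x| < pi/|u| the cosine is below 1, and on at least one side of 0 the density is
  positive on a whole interval of such x.\<close>

lemma not_AE_cos_eq_one: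
  assumes "0 \<le> c_pos" "0 \<le> c_neg" "0 < c_pos + c_neg" "u \<noteq> 0"
  shows "\<not> (AE x in stable_levy_measure \<alpha> c_pos c_neg. cos (u * x) = 1)"
proof
  let ?w = "\<lambda>x. (c_pos * indicator {0<..} x + c_neg * indicator {..<0} x) * \<bar>x\<bar> powr (- 1 - \<alpha>)"
  assume "AE x in stable_levy_measure \<alpha> c_pos c_neg. cos (u * x) = 1"
  then have AE: "AE x in lborel. 0 < ennreal (?w x) \<longrightarrow> cos (u * x) = 1"
    unfolding stable_levy_measure_def by (subst (asm) AE_density) auto
  define r where "r = pi / \<bar>u\<bar>"
  have r: "0 < r" using assms by (simp add: r_def)
  have cos_ne: "cos (u * x) \<noteq> 1" if "x \<noteq> 0" "\<bar>x\<bar> < r" for x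
  proof -
    have "\<bar>u * x\<bar> < pi" "0 < \<bar>u * x\<bar>"
      using that assms(4) by (auto simp: r_def abs_mult field_simps)
    then have "cos \<bar>u * x\<bar> < cos 0" by (intro cos_monotone_0_pi) auto
    then show ?thesis by simp
  qed
  have "\<exists>a b. a < b \<and> (\<forall>x\<in>{a<..<b}. 0 < ?w x \<and> x \<noteq> 0 \<and> \<bar>x\<bar> < r)"
  proof (cases "c_pos > 0")
    case True
    then show ?thesis using r by (intro exI[of _ 0] exI[of _ r]) auto
  next
    case False
    then have "c_neg > 0" using assms by auto
    then show ?thesis using r by (intro exI[of _ "-r"] exI[of _ 0]) auto
  qed
  then obtain a b where ab: "a < b" "\<And>x. x \<in> {a<..<b} \<Longrightarrow> 0 < ?w x \<and> x \<noteq> 0 \<and> \<bar>x\<bar> < r" by blast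
  have "AE x in lborel. x \<notin> {a<..<b}"
    using AE
  proof eventually_elim
    case (elim x)
    then show ?case using ab(2)[of x] cos_ne[of x] by (metis ennreal_less_zero_iff)
  qed
  moreover have "{x \<in> space lborel. \<not> x \<notin> {a<..<b}} = {a<..<b}" by auto
  ultimately have "emeasure lborel {a<..<b} = 0"
    by (subst (asm) AE_iff_measurable) auto
  then show False using ab(1) by simp
qed

text \<open>Drift and compensator are purely imaginary, so the real part is -\<sigma>^2 u^2 / 2 plus
  the integral of cos(u x) - 1, which is nonpositive and vanishes only if the cosine is 1 almost
  everywhere.\<close>

lemma Re_levy_exponent_neg:
  fixes \<nu> :: "real measure"
  assumes sets[measurable_cong]: "sets \<nu> = sets borel" and int: "integrable \<nu> (\<lambda>x. min 1 (x\<^sup>2))"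
    and ne: "\<not> (AE x in \<nu>. cos (u * x) = 1)"
  shows "Re (levy_khintchine_exponent b \<sigma> \<nu> u) < 0"
proof -
  let ?\<phi> = "\<lambda>x. iexp (u * x) - 1 - \<i> * of_real (u * x * indicator {-1..1} x)"
  \<comment> \<open>Second-order Taylor on [-1, 1], where the compensator is active, and the trivial
    bound outside. The resulting integrability is what allows real parts to be taken under the
    integral.\<close>
  have bound: "cmod (?\<phi> x) \<le> (2 + u\<^sup>2) * min 1 (x\<^sup>2)" for x
  proof (cases "x \<in> {-1..1}")
    case True
    have "cmod (?\<phi> x) = cmod (iexp (u * x) - (\<Sum>k \<le> 1. (\<i> * (u * x))^k / fact k))"
      using True by (simp add: algebra_simps)
    also have "\<dots> \<le> \<bar>u * x\<bar>^2 / 2" using iexp_approx1[of "u * x" 1] by (simp add: numeral_2_eq_2)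
    also have "\<dots> \<le> (2 + u\<^sup>2) * x\<^sup>2" by (simp add: power_mult_distrib algebra_simps)
    also have "x\<^sup>2 = min 1 (x\<^sup>2)" using True by (auto simp: abs_square_le_1 abs_le_iff)
    finally show ?thesis .
  next
    case False
    have "cmod (?\<phi> x) \<le> cmod (iexp (u * x)) + cmod 1"
      using False norm_triangle_ineq4[of "iexp (u * x)" 1] by simp
    also have "\<dots> \<le> 2 + u\<^sup>2" by simp
    also have "min 1 (x\<^sup>2) = 1"
    proof -
      have "1 < \<bar>x\<bar>" using False by auto
      then have "1 \<le> \<bar>x\<bar>\<^sup>2" by (intro one_le_power) auto
      then show ?thesis by simp
    qed
    then have "2 + u\<^sup>2 = (2 + u\<^sup>2) * min 1 (x\<^sup>2)" by simp
    finally show ?thesis .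
  qed
  have int\<phi>: "integrable \<nu> ?\<phi>"
    by (rule Bochner_Integration.integrable_bound[OF integrable_mult_right[OF int, of "2 + u\<^sup>2"]])
       (use bound in \<open>auto simp: abs_mult\<close>)
  have Re: "Re (?\<phi> x) = cos (u * x) - 1" for x
    by (simp add: Re_exp)
  have intc: "integrable \<nu> (\<lambda>x. cos (u * x) - 1)"
    using integrable_Re[OF int\<phi>] unfolding Re .
  have "(\<integral>x. 1 - cos (u * x) \<partial>\<nu>) \<noteq> 0"
  proof
    assume "(\<integral>x. 1 - cos (u * x) \<partial>\<nu>) = 0"
    moreover have "integrable \<nu> (\<lambda>x. 1 - cos (u * x))"
      using integrable_minus[OF intc] by simp
    ultimately have "AE x in \<nu>. 1 - cos (u * x) = 0"
      by (subst (asm) integral_nonneg_eq_0_iff_AE) auto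
    then show False using ne by (auto elim!: eventually_mono)
  qed
  moreover have "0 \<le> (\<integral>x. 1 - cos (u * x) \<partial>\<nu>)" by (intro integral_nonneg_AE) auto
  moreover have "(\<integral>x. 1 - cos (u * x) \<partial>\<nu>) = - (\<integral>x. cos (u * x) - 1 \<partial>\<nu>)"
    by (subst Bochner_Integration.integral_minus[symmetric]) simp
  ultimately have "(\<integral>x. cos (u * x) - 1 \<partial>\<nu>) < 0" by linarith
  moreover have "Re (CLINT x|\<nu>. ?\<phi> x) = (\<integral>x. cos (u * x) - 1 \<partial>\<nu>)"
    unfolding Re[symmetric] by (rule integral_Re[OF int\<phi>, symmetric])
  ultimately have "Re (levy_khintchine_exponent b \<sigma> \<nu> u) + \<sigma>\<^sup>2 * u\<^sup>2 / 2 < 0"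
    unfolding levy_khintchine_exponent_def by simp
  moreover have "0 \<le> \<sigma>\<^sup>2 * u\<^sup>2 / 2" by simp
  ultimately show ?thesis by linarith
qed

section \<open>Stable scaling and tightness\<close>

lemma stable_marginal_scaling:
  assumes "filtration_on M F" "strictly_stable_process M F \<alpha> B" "0 < c" "0 \<le> t"
  shows "distr M borel (B (c * t)) = distr M borel (\<lambda>\<omega>. c powr (1 / \<alpha>) * B t \<omega>)"
proof -
  have ad: "adapted F B" using assms(2) by (simp add: strictly_stable_process_def levy_process_def)
  note B = levy_process_measurable[OF assms(1) ad]
  have law: "distr (process_law M Y) borel (\<lambda>w. w t) = distr M borel (Y t)"
    if "\<And>s. 0 \<le> s \<Longrightarrow> Y s \<in> borel_measurable M" for Y :: "real \<Rightarrow> 'a \<Rightarrow> real"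
  proof -
    have 1: "(\<lambda>\<omega>. \<lambda>s\<in>{0..}. Y s \<omega>) \<in> measurable M (Pi\<^sub>M {0..} (\<lambda>_. borel))"
      using that by (intro measurable_restrict) auto
    have 2: "(\<lambda>w. w t) \<in> measurable (Pi\<^sub>M {0..} (\<lambda>_. borel)) borel"
      using assms(4) by (intro measurable_component_singleton) auto
    show ?thesis
      unfolding process_law_def using assms(4)
      by (subst distr_distr[OF 2 1]) (auto simp: comp_def intro!: distr_cong)
  qed
  have "process_law M (\<lambda>t. B (c * t)) = process_law M (\<lambda>t \<omega>. c powr (1 / \<alpha>) * B t \<omega>)"
    using assms by (simp add: strictly_stable_process_def)
  then have "distr (process_law M (\<lambda>t. B (c * t))) borel (\<lambda>w. w t) =
      distr (process_law M (\<lambda>t \<omega>. c powr (1 / \<alpha>) * B t \<omega>)) borel (\<lambda>w. w t)" by simp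
  moreover have "distr (process_law M (\<lambda>t. B (c * t))) borel (\<lambda>w. w t) = distr M borel (B (c * t))"
    using law[of "\<lambda>t. B (c * t)"] B assms(3) by simp
  moreover have "distr (process_law M (\<lambda>t \<omega>. c powr (1 / \<alpha>) * B t \<omega>)) borel (\<lambda>w. w t) =
      distr M borel (\<lambda>\<omega>. c powr (1 / \<alpha>) * B t \<omega>)"
    using law[of "\<lambda>t \<omega>. c powr (1 / \<alpha>) * B t \<omega>"] B by simp
  ultimately show ?thesis by simp
qed

text \<open>Here \<kappa> = -\<psi>(u), with \<psi> the real part of the exponent: Levy-Khintchine
  gives linearity in t, scaling gives \<psi>(u c) = c^\<alpha> \<psi>(u) for c > 0. Passing to
  moduli discards everything about the imaginary part.\<close>

lemma stable_char_modulus: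
  assumes "prob_space M" "filtration_on M F" "strictly_stable_process M F \<alpha> B" "0 < \<alpha>"
    and "has_levy_measure M B (stable_levy_measure \<alpha> c_pos c_neg)"
    and "0 \<le> c_pos" "0 \<le> c_neg" "0 < c_pos + c_neg" "u \<noteq> 0"
  shows "\<exists>\<kappa>>0. \<forall>t\<ge>0. \<forall>c>0. cmod (char (distr M borel (B t)) (u * c)) = exp (- (\<kappa> * t * c powr \<alpha>))"
proof -
  let ?\<nu> = "stable_levy_measure \<alpha> c_pos c_neg"
  obtain b \<sigma> where lk: "\<And>t u. 0 \<le> t \<Longrightarrow>
      char (distr M borel (B t)) u = exp (of_real t * levy_khintchine_exponent b \<sigma> ?\<nu> u)"
    and int: "integrable ?\<nu> (\<lambda>x. min 1 (x\<^sup>2))"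
    using assms(5) unfolding has_levy_measure_def by blast
  define \<psi> where "\<psi> v = Re (levy_khintchine_exponent b \<sigma> ?\<nu> v)" for v
  have mod: "cmod (char (distr M borel (B t)) v) = exp (t * \<psi> v)" if "0 \<le> t" for t v
    using lk[OF that, of v] by (simp add: \<psi>_def)
  have neg: "\<psi> u < 0"
    unfolding \<psi>_def using not_AE_cos_eq_one[OF assms(6-9)] int
    by (intro Re_levy_exponent_neg sets_stable_levy_measure) auto
  have ad: "adapted F B" using assms(3) by (simp add: strictly_stable_process_def levy_process_def)
  note B = levy_process_measurable[OF assms(2) ad]
  have scaling: "\<psi> (u * c) = c powr \<alpha> * \<psi> u" if c: "0 < c" for c
  proof -
    have "exp (\<psi> (u * c)) = cmod (char (distr M borel (B 1)) (u * c))" using mod[of 1] by simp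
    also have "\<dots> = cmod (char (distr M borel (\<lambda>\<omega>. c * B 1 \<omega>)) u)"
      by (subst char_distr_cmult) (use B[of 1] in auto)
    \<comment> \<open>A spatial factor c corresponds to the time factor c^\<alpha>.\<close>
    also have "(\<lambda>\<omega>. c * B 1 \<omega>) = (\<lambda>\<omega>. (c powr \<alpha>) powr (1 / \<alpha>) * B 1 \<omega>)"
      using c assms(4) by (simp add: powr_powr)
    also have "distr M borel \<dots> = distr M borel (B (c powr \<alpha> * 1))"
      using stable_marginal_scaling[OF assms(2,3), of "c powr \<alpha>" 1] c by simp
    also have "cmod (char \<dots> u) = exp (c powr \<alpha> * \<psi> u)" using mod[of "c powr \<alpha> * 1" u] by simp
    finally show ?thesis by simp
  qed
  have "cmod (char (distr M borel (B t)) (u * c)) = exp (- (- \<psi> u * t * c powr \<alpha>))"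
    if "0 \<le> t" "0 < c" for t c
    unfolding mod[OF that(1)] scaling[OF that(2)] by (simp add: mult_ac)
  then show ?thesis using neg by (intro exI[of _ "- \<psi> u"]) auto
qed

text \<open>Scaling of the law of the whole process removes t, and almost every path is bounded on
  [0, 2]. Restricting to rational times makes the event depend on countably many coordinates, hence
  measurable; 2 covers the window because ratio <= 2.\<close>

lemma stable_sup_tight:
  assumes "prob_space M" "filtration_on M F" "strictly_stable_process M F \<alpha> B" "0 < e"
  shows "\<exists>K0. \<forall>K\<ge>K0. \<forall>t>0. 1 - e \<le> measure M {\<omega>\<in>space M. \<forall>q\<in>\<rat>\<inter>{0..2}. \<bar>B (t * q) \<omega>\<bar> \<le> K * t powr (1 / \<alpha>)}"
proof -
  interpret prob_space M by fact
  have ad: "adapted F B" using assms(3) by (simp add: strictly_stable_process_def levy_process_def)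
  note B = levy_process_measurable[OF assms(2) ad]
  let ?P = "Pi\<^sub>M {0..} (\<lambda>_. borel) :: (real \<Rightarrow> real) measure"
  let ?Q = "\<rat> \<inter> {0..2::real}"
  have Q: "countable ?Q" using countable_rat by (rule countable_subset[rotated]) auto
  have meas: "{\<omega>\<in>space M. \<forall>q\<in>?Q. \<bar>B (t * q) \<omega>\<bar> \<le> k} \<in> sets M" if "0 \<le> t" for t k
    by (rule sets.sets_Collect_countable_All'[OF _ Q])
       (use B that in \<open>auto intro!: borel_measurable_le borel_measurable_abs measurable_sets_borel\<close>)
  have law: "measure (process_law M Y) {w\<in>space ?P. \<forall>q\<in>?Q. \<bar>w q\<bar> \<le> k} =
      measure M {\<omega>\<in>space M. \<forall>q\<in>?Q. \<bar>Y q \<omega>\<bar> \<le> k}"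
    if "\<And>s. 0 \<le> s \<Longrightarrow> Y s \<in> borel_measurable M" for k and Y :: "real \<Rightarrow> 'a \<Rightarrow> real"
  proof -
    have 1: "(\<lambda>\<omega>. \<lambda>s\<in>{0..}. Y s \<omega>) \<in> measurable M ?P"
      using that by (intro measurable_restrict) auto
    have "{w\<in>space ?P. \<bar>w q\<bar> \<le> k} \<in> sets ?P" if "q \<in> ?Q" for q
    proof -
      have [measurable]: "(\<lambda>w. w q) \<in> measurable ?P borel"
        using that by (intro measurable_component_singleton) auto
      show ?thesis by measurable
    qed
    then have 2: "{w\<in>space ?P. \<forall>q\<in>?Q. \<bar>w q\<bar> \<le> k} \<in> sets ?P"
      by (intro sets.sets_Collect_countable_All' Q)
    show ?thesis
      unfolding process_law_def measure_distr[OF 1 2]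
      using measurable_space[OF 1] by (intro arg_cong[where f = "measure M"]) auto
  qed
  have scaling: "measure M {\<omega>\<in>space M. \<forall>q\<in>?Q. \<bar>B (t * q) \<omega>\<bar> \<le> K * t powr (1 / \<alpha>)} =
      measure M {\<omega>\<in>space M. \<forall>q\<in>?Q. \<bar>B q \<omega>\<bar> \<le> K}" if t: "0 < t" for t K
  proof -
    have "process_law M (\<lambda>s. B (t * s)) = process_law M (\<lambda>s \<omega>. t powr (1 / \<alpha>) * B s \<omega>)"
      using assms(3) t by (simp add: strictly_stable_process_def)
    then have "measure M {\<omega>\<in>space M. \<forall>q\<in>?Q. \<bar>B (t * q) \<omega>\<bar> \<le> K * t powr (1 / \<alpha>)} =
        measure M {\<omega>\<in>space M. \<forall>q\<in>?Q. \<bar>t powr (1 / \<alpha>) * B q \<omega>\<bar> \<le> K * t powr (1 / \<alpha>)}"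
      using law[of "\<lambda>s. B (t * s)"] law[of "\<lambda>s \<omega>. t powr (1 / \<alpha>) * B s \<omega>"] B t by simp
    also have "{\<omega>\<in>space M. \<forall>q\<in>?Q. \<bar>t powr (1 / \<alpha>) * B q \<omega>\<bar> \<le> K * t powr (1 / \<alpha>)} =
        {\<omega>\<in>space M. \<forall>q\<in>?Q. \<bar>B q \<omega>\<bar> \<le> K}"
      using t by (simp add: abs_mult mult.commute[of K])
    finally show ?thesis .
  qed
  define E where "E n = {\<omega>\<in>space M. \<forall>q\<in>?Q. \<bar>B q \<omega>\<bar> \<le> real n}" for n :: nat
  have E: "E n \<in> sets M" for n using meas[of 1 "real n"] by (simp add: E_def)
  have "(\<lambda>n. measure M (E n)) \<longlonglongrightarrow> measure M (\<Union>n. E n)"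
  proof (rule finite_Lim_measure_incseq)
    show "range E \<subseteq> sets M" using E by auto
    show "incseq E"
      unfolding incseq_def le_fun_def E_def by (auto intro: order_trans)
  qed
  moreover have "measure M (\<Union>n. E n) = 1"
  proof -
    have "AE \<omega> in M. cadlag (\<lambda>t. B t \<omega>)"
      using assms(3) by (simp add: strictly_stable_process_def levy_process_def)
    then have "AE \<omega> in M. \<omega> \<in> (\<Union>n. E n)"
      using AE_space
    proof eventually_elim
      case (elim \<omega>)
      then obtain C where C: "\<forall>s\<in>{0..2}. \<bar>B s \<omega>\<bar> \<le> C" using cadlag_bounded by blast
      obtain n :: nat where "C \<le> real n" using real_arch_simple by blast
      then have "\<omega> \<in> E n" using C elim by (force simp: E_def)
      then show ?case by blast
    qed
    then show ?thesis using E by (subst prob_eq_1) auto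
  qed
  ultimately have "eventually (\<lambda>n. 1 - e < measure M (E n)) sequentially"
    using assms(4) by (intro order_tendstoD) auto
  then obtain n where n: "1 - e < measure M (E n)"
    unfolding eventually_sequentially by blast
  have "1 - e \<le> measure M {\<omega>\<in>space M. \<forall>q\<in>?Q. \<bar>B (t * q) \<omega>\<bar> \<le> K * t powr (1 / \<alpha>)}"
    if "real n \<le> K" "0 < t" for K t
  proof -
    have "measure M (E n) \<le> measure M {\<omega>\<in>space M. \<forall>q\<in>?Q. \<bar>B q \<omega>\<bar> \<le> K}"
      using meas[of 1 K] that unfolding E_def by (intro finite_measure_mono) force+
    then show ?thesis unfolding scaling[OF that(2)] using n by linarith
  qed
  then show ?thesis by blast
qed

section \<open>Consequences of a weak limit: tightness, and contradiction from a contraction\<close>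

lemma weak_conv_m_tight:
  assumes "\<And>n. real_distribution (\<mu> n)" "real_distribution \<nu>" "weak_conv_m \<mu> \<nu>" "0 < e"
  shows "\<exists>K0. \<forall>K\<ge>K0. eventually (\<lambda>n. 1 - e \<le> measure (\<mu> n) {-K..K}) sequentially"
proof -
  interpret \<nu>: real_distribution \<nu> by fact
  have mono: "mono (cdf \<nu>)" by (auto intro: monoI \<nu>.cdf_nondecreasing)
  have "eventually (\<lambda>x. cdf \<nu> x < e / 2) at_bot"
    using assms(4) by (intro order_tendstoD(2)[OF \<nu>.cdf_lim_at_bot]) auto
  then obtain a' where a': "\<And>x. x \<le> a' \<Longrightarrow> cdf \<nu> x < e / 2"
    unfolding eventually_at_bot_linorder by blast
  have "eventually (\<lambda>x. 1 - e / 2 < cdf \<nu> x) at_top"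
    using assms(4) by (intro order_tendstoD(1)[OF \<nu>.cdf_lim_at_top_prob]) auto
  then obtain b' where b': "\<And>x. b' \<le> x \<Longrightarrow> 1 - e / 2 < cdf \<nu> x"
    unfolding eventually_at_top_linorder by blast
  \<comment> \<open>A monotone function has countably many discontinuities, so continuity points
    exist arbitrarily far out on both sides.\<close>
  obtain a where a: "a < min a' 0" "isCont (cdf \<nu>) a"
    using open_minus_countable[OF mono_ctble_discont[OF mono], of "{..<min a' 0}"] by auto
  obtain b where b: "max b' 0 < b" "isCont (cdf \<nu>) b"
    using open_minus_countable[OF mono_ctble_discont[OF mono], of "{max b' 0<..}"] by auto
  have conv: "(\<lambda>n. cdf (\<mu> n) x) \<longlonglongrightarrow> cdf \<nu> x" if "isCont (cdf \<nu>) x" for x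
    using assms(3) that by (simp add: weak_conv_m_def weak_conv_def)
  have ev: "eventually (\<lambda>n. cdf (\<mu> n) a < e / 2) sequentially"
    "eventually (\<lambda>n. 1 - e / 2 < cdf (\<mu> n) b) sequentially"
    using order_tendstoD(2)[OF conv[OF a(2)] a'] order_tendstoD(1)[OF conv[OF b(2)] b'] a(1) b(1) by auto
  have "eventually (\<lambda>n. 1 - e \<le> measure (\<mu> n) {-K..K}) sequentially" if K: "max (- a) b \<le> K" for K
    using ev
  proof eventually_elim
    case (elim n)
    interpret \<mu>: real_distribution "\<mu> n" by fact
    have "cdf (\<mu> n) b - cdf (\<mu> n) a = measure (\<mu> n) {a<..b}"
      using a b by (intro \<mu>.cdf_diff_eq) auto
    also have "\<dots> \<le> measure (\<mu> n) {-K..K}"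
      using K by (intro \<mu>.finite_measure_mono) auto
    finally show ?case using elim by linarith
  qed
  then show ?thesis by blast
qed

text \<open>A strict factor at the single point 1 suffices, since the iteration already forces
  modulus 1 everywhere. Iterates d^n u must stay nonzero for \<open>all\<close> to apply, so d = 0
  is treated apart.\<close>

lemma char_contraction_False:
  assumes "real_distribution \<mu>" "0 \<le> d" "d < 1" "q < 1"
    and all: "\<And>u. u \<noteq> 0 \<Longrightarrow> cmod (char \<mu> (d * u)) \<le> cmod (char \<mu> u)"
    and strict: "cmod (char \<mu> d) \<le> q * cmod (char \<mu> 1)"
  shows False
proof -
  interpret real_distribution \<mu> by fact
  have iter: "cmod (char \<mu> (d ^ n * u)) \<le> cmod (char \<mu> u)" if "u \<noteq> 0" for n u
  proof (cases "d = 0")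
    case True
    then show ?thesis using all[OF that] by (cases n) auto
  next
    case False
    show ?thesis
    proof (induction n)
      case (Suc n)
      have "cmod (char \<mu> (d * (d ^ n * u))) \<le> cmod (char \<mu> (d ^ n * u))"
        using False that by (intro all) auto
      then show ?case using Suc by (simp add: mult.assoc)
    qed simp
  qed
  have one: "1 \<le> cmod (char \<mu> u)" if "u \<noteq> 0" for u
  proof -
    have "(\<lambda>n. d ^ n * u) \<longlonglongrightarrow> 0 * u"
      using assms(2,3) by (intro tendsto_mult LIMSEQ_realpow_zero tendsto_const)
    then have "(\<lambda>n. cmod (char \<mu> (d ^ n * u))) \<longlonglongrightarrow> cmod (char \<mu> 0)"
      using isCont_tendsto_compose[OF isCont_char] by (intro tendsto_norm) fastforce
    then have "cmod (char \<mu> 0) \<le> cmod (char \<mu> u)"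
      by (rule LIMSEQ_le_const2) (use iter[OF that] in auto)
    then show ?thesis by (simp add: char_zero)
  qed
  have "cmod (char \<mu> 1) = 1" using one[of 1] cmod_char_le_1[of 1] by simp
  then have "cmod (char \<mu> d) \<le> q" using strict by simp
  moreover have "1 \<le> cmod (char \<mu> d)"
    using one[of d] by (cases "d = 0") (auto simp: char_zero)
  ultimately show False using assms(4) by linarith
qed

section \<open>Comparing two times\<close>

text \<open>The cap at 2 keeps the expectation of the bound finite without any moment assumption, as
  is needed for stable laws.\<close>

lemma cmod_iexp_diff_le: "cmod (iexp v - iexp w) \<le> min 2 \<bar>v - w\<bar>"
proof -
  have "iexp v - iexp w = iexp w * (iexp (v - w) - 1)"
    by (simp add: algebra_simps exp_diff)
  then have 1: "cmod (iexp v - iexp w) = cmod (iexp (v - w) - 1)"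
    by (simp add: norm_mult)
  have "cmod (iexp (v - w) - 1) \<le> \<bar>v - w\<bar>"
    using iexp_approx1[of "v - w" 0] by simp
  moreover have "cmod (iexp v - iexp w) \<le> 2"
    using norm_triangle_ineq4[of "iexp v" "iexp w"] by simp
  ultimately show ?thesis unfolding 1 by simp
qed

lemma (in prob_space) char_distr_diff_le:
  assumes [measurable]: "V \<in> borel_measurable M" "W \<in> borel_measurable M"
  shows "cmod (char (distr M borel V) u - char (distr M borel W) u) \<le>
    expectation (\<lambda>\<omega>. min 2 \<bar>u * (V \<omega> - W \<omega>)\<bar>)"
proof -
  have int: "integrable M (\<lambda>\<omega>. iexp (u * Y \<omega>))" if "Y \<in> borel_measurable M" for Y
    using that by (intro integrable_iexp) auto
  have "char (distr M borel V) u - char (distr M borel W) u =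
      (CLINT \<omega>|M. iexp (u * V \<omega>) - iexp (u * W \<omega>))"
    unfolding char_def
    by (subst (1 2) integral_distr; (rule Bochner_Integration.integral_diff[OF int int, symmetric])?) auto
  also have "cmod \<dots> \<le> expectation (\<lambda>\<omega>. cmod (iexp (u * V \<omega>) - iexp (u * W \<omega>)))"
    by (rule integral_norm_bound)
  also have "\<dots> \<le> expectation (\<lambda>\<omega>. min 2 \<bar>u * (V \<omega> - W \<omega>)\<bar>)"
  proof (rule integral_mono)
    show "integrable M (\<lambda>\<omega>. cmod (iexp (u * V \<omega>) - iexp (u * W \<omega>)))"
      by (intro integrable_norm Bochner_Integration.integrable_diff int) auto
    show "integrable M (\<lambda>\<omega>. min 2 \<bar>u * (V \<omega> - W \<omega>)\<bar>)"
      by (rule integrable_const_bound[where B = 2]) auto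
    show "cmod (iexp (u * V \<omega>) - iexp (u * W \<omega>)) \<le> min 2 \<bar>u * (V \<omega> - W \<omega>)\<bar>" for \<omega>
      using cmod_iexp_diff_le[of "u * V \<omega>" "u * W \<omega>"] by (simp add: right_diff_distrib)
  qed
  finally show ?thesis .
qed

text \<open>A time s < 2t is approached from the right by t q with q rational in [0, 2]. For s = 2t
  no such q lies to the right, but 2 is itself rational.\<close>

lemma cadlag_bounded_by_rationals:
  assumes "cadlag b" "0 < t" and K: "\<And>q. q \<in> \<rat> \<inter> {0..2} \<Longrightarrow> \<bar>b (t * q)\<bar> \<le> K" and s: "s \<in> {0..2 * t}"
  shows "\<bar>b s\<bar> \<le> K"
proof (cases "s = 2 * t")
  case True
  then show ?thesis using K[of 2] by (simp add: mult.commute)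
next
  case False
  then have "s / t < 2" using s assms(2) by (simp add: field_simps)
  then have lt: "s / t < min 2 (s / t + 1 / real (Suc n))" for n by simp
  have "\<exists>q. q \<in> \<rat> \<and> s / t < q \<and> q < min 2 (s / t + 1 / real (Suc n))" for n
    using Rats_dense_in_real[OF lt[of n]] by blast
  then obtain q where q: "\<And>n. q n \<in> \<rat>" "\<And>n. s / t < q n" "\<And>n. q n < min 2 (s / t + 1 / real (Suc n))"
    by metis
  have "q \<longlonglongrightarrow> s / t"
  proof (rule tendsto_sandwich[OF _ _ tendsto_const])
    show "(\<lambda>n. s / t + 1 / real (Suc n)) \<longlonglongrightarrow> s / t"
      using tendsto_add[OF tendsto_const LIMSEQ_Suc[OF lim_const_over_n[of 1]], of "s / t"] by simp
  qed (use q in \<open>auto intro!: always_eventually less_imp_le\<close>)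
  then have lim: "(\<lambda>n. t * q n) \<longlonglongrightarrow> t * (s / t)" by (intro tendsto_intros)
  have "(b \<longlongrightarrow> b s) (at_right s)" using assms(1) s by (auto simp: cadlag_def)
  moreover have "s \<le> t * q n" for n using q(2)[of n] assms(2) by (simp add: field_simps)
  ultimately have "(\<lambda>n. b (t * q n)) \<longlonglongrightarrow> b s"
    using lim assms(2) by (intro right_continuous_seq[of b s "\<lambda>n. t * q n"]) auto
  then have "(\<lambda>n. \<bar>b (t * q n)\<bar>) \<longlonglongrightarrow> \<bar>b s\<bar>" by (rule tendsto_rabs)
  moreover have "\<bar>b (t * q n)\<bar> \<le> K" for n
  proof (rule K)
    have "0 \<le> s / t" using s assms(2) by simp
    then show "q n \<in> \<rat> \<inter> {0..2}" using q(1)[of n] q(2)[of n] q(3)[of n] by auto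
  qed
  ultimately show ?thesis by (intro LIMSEQ_le_const2) auto
qed

locale stable_drift_sde = power_drift \<alpha> \<beta> a f + prob_space M
  for \<alpha> \<beta> a :: real and f :: "real \<Rightarrow> real" and M :: "'a measure" +
  fixes F :: "real \<Rightarrow> 'a measure" and B X :: "real \<Rightarrow> 'a \<Rightarrow> real" and c_pos c_neg :: real
  assumes filtration: "filtration_on M F"
    and stable: "strictly_stable_process M F \<alpha> B"
    and levy_measure: "has_levy_measure M B (stable_levy_measure \<alpha> c_pos c_neg)"
    and c_nonneg: "0 \<le> c_pos" "0 \<le> c_neg" and c_sum_pos: "0 < c_pos + c_neg"
    and sde: "sde_solution M F f B X"
    and X_top: "AE \<omega> in M. filterlim (\<lambda>t. X t \<omega>) at_top at_top"
begin

section \<open>Two-time comparison through Riemann sums\<close>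

definition "Z s \<omega> = (X s \<omega> - g s) / s powr (1 / \<alpha>)"
definition grid :: "real \<Rightarrow> nat \<Rightarrow> nat \<Rightarrow> real"
  where "grid t m k = t + (ratio * t - t) * real k / real m"
text \<open>Z(t) plus the m-cell left Riemann sum for N(t). Weights at left grid points are
  deterministic, so the increments stay independent given the past.\<close>

definition "U t m \<omega> = Z t \<omega> + (\<Sum>k<m. t powr (\<gamma> - 1 / \<alpha>) * grid t m k powr (-\<gamma>) *
  (B (grid t m (Suc k)) \<omega> - B (grid t m k) \<omega>))"
definition "V t \<omega> = ratio powr (1 / \<alpha> - \<gamma>) * Z (ratio * t) \<omega>"
text \<open>Written as a limit of measurable functions so that measurability is immediate; the
  identification with the pathwise \<open>remainder\<close> holds on almost every path.\<close>

definition "R t \<omega> = lim (\<lambda>m. V t \<omega> - U t m \<omega>)"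

lemma levy: "levy_process M F B"
  using stable by (simp add: strictly_stable_process_def)

lemma B_measurable: "0 \<le> t \<Longrightarrow> B t \<in> borel_measurable M"
  using levy_process_measurable[OF filtration] levy by (simp add: levy_process_def)

lemma X_measurable: "0 \<le> t \<Longrightarrow> X t \<in> borel_measurable M"
  using levy_process_measurable[OF filtration] sde by (simp add: sde_solution_def)

lemma Z_adapted: "0 \<le> t \<Longrightarrow> Z t \<in> borel_measurable (F t)"
  using sde unfolding Z_def[abs_def] sde_solution_def adapted_def
  by (intro borel_measurable_divide borel_measurable_diff borel_measurable_const) auto

lemma Z_measurable: "0 \<le> t \<Longrightarrow> Z t \<in> borel_measurable M"
  using X_measurable unfolding Z_def[abs_def] by simp

lemma V_measurable: "0 \<le> t \<Longrightarrow> V t \<in> borel_measurable M"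
  using Z_measurable[of "ratio * t"] ratio_bounds unfolding V_def[abs_def] by simp

lemma grid_bounds:
  assumes "0 < t" "k \<le> m"
  shows "t \<le> grid t m k" "grid t m k \<le> 2 * t"
proof -
  have "0 \<le> (ratio - 1) * t" using ratio_bounds assms by simp
  moreover have "real k / real m \<le> 1" using assms by (simp add: divide_le_eq)
  ultimately have "(ratio - 1) * t * (real k / real m) \<le> (ratio - 1) * t * 1"
    "0 \<le> (ratio - 1) * t * (real k / real m)"
    by (intro mult_left_mono, auto)
  moreover have "grid t m k = t + (ratio - 1) * t * (real k / real m)"
    by (simp add: grid_def left_diff_distrib)
  moreover have "ratio * t \<le> 2 * t" using ratio_bounds assms by simp
  ultimately show "t \<le> grid t m k" "grid t m k \<le> 2 * t" by (auto simp: algebra_simps)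
qed

lemma grid_nonneg: "0 \<le> t \<Longrightarrow> 0 \<le> grid t m k"
  using ratio_bounds mult_right_mono[of 1 ratio t] unfolding grid_def
  by (intro add_nonneg_nonneg divide_nonneg_nonneg mult_nonneg_nonneg) auto

lemma grid_step: "grid t m (Suc k) - grid t m k = (ratio - 1) * t / real m"
  by (simp add: grid_def diff_divide_distrib[symmetric] algebra_simps)

lemma U_measurable: "0 \<le> t \<Longrightarrow> U t m \<in> borel_measurable M"
  unfolding U_def[abs_def] using Z_measurable B_measurable grid_nonneg
  by (intro borel_measurable_add borel_measurable_sum borel_measurable_times borel_measurable_diff) auto

lemma R_measurable: "0 \<le> t \<Longrightarrow> R t \<in> borel_measurable M"
  unfolding R_def[abs_def]
  by (intro borel_measurable_lim_metric borel_measurable_diff V_measurable U_measurable)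

lemma AE_path: "AE \<omega> in M. power_drift_path \<alpha> \<beta> a f (\<lambda>t. X t \<omega>) (\<lambda>t. B t \<omega>)"
proof -
  have "AE \<omega> in M. cadlag (\<lambda>t. B t \<omega>)" using levy by (simp add: levy_process_def)
  moreover have "AE \<omega> in M. cadlag (\<lambda>t. X t \<omega>)"
    "AE \<omega> in M. \<forall>t\<ge>0. X t \<omega> = X 0 \<omega> + (LBINT s:{0..t}. f (X s \<omega>)) + B t \<omega>"
    using sde by (auto simp: sde_solution_def)
  ultimately show ?thesis
    using X_top
  proof eventually_elim
    case (elim \<omega>)
    show ?case
    proof (intro power_drift_path.intro power_drift_path_axioms.intro power_drift_axioms)
      show "X t \<omega> = X 0 \<omega> + (LBINT s:{0..t}. f (X s \<omega>)) + B t \<omega>" if "0 \<le> t" for t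
        using elim(3) that by blast
    qed (fact elim)+
  qed
qed

lemma path_limit:
  assumes "power_drift_path \<alpha> \<beta> a f (\<lambda>t. X t \<omega>) (\<lambda>t. B t \<omega>)" "0 < t"
  shows "(\<lambda>m. V t \<omega> - U t m \<omega>) \<longlonglongrightarrow> power_drift_path.remainder \<alpha> \<beta> a f (\<lambda>t. X t \<omega>) t"
proof -
  interpret P: power_drift_path \<alpha> \<beta> a f "\<lambda>t. X t \<omega>" "\<lambda>t. B t \<omega>" by fact
  have "t powr (\<gamma> - 1 / \<alpha>) * ((ratio * t) powr (-\<gamma>) * P.y (ratio * t) - t powr (-\<gamma>) * P.y t -
      (\<Sum>k<m. (t + (ratio * t - t) * real k / real m) powr (-\<gamma>) *
         (B (t + (ratio * t - t) * real (Suc k) / real m) \<omega> - B (t + (ratio * t - t) * real k / real m) \<omega>))) =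
    V t \<omega> - U t m \<omega>" for m
  proof -
    have r: "0 < ratio" using ratio_bounds by simp
    have "t powr (\<gamma> - 1 / \<alpha>) * (ratio * t) powr (-\<gamma>) = ratio powr (1 / \<alpha> - \<gamma>) / (ratio * t) powr (1 / \<alpha>)"
      using assms(2) r by (simp add: powr_mult powr_diff powr_minus field_simps)
    then have 1: "t powr (\<gamma> - 1 / \<alpha>) * ((ratio * t) powr (-\<gamma>) * P.y (ratio * t)) = V t \<omega>"
      by (simp add: V_def Z_def P.y_def mult.assoc[symmetric])
    have "t powr (\<gamma> - 1 / \<alpha>) * t powr (-\<gamma>) = 1 / t powr (1 / \<alpha>)"
      using assms(2) by (simp add: powr_diff powr_minus field_simps)
    then have 2: "t powr (\<gamma> - 1 / \<alpha>) * (t powr (-\<gamma>) * P.y t) = Z t \<omega>"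
      by (simp add: Z_def P.y_def mult.assoc[symmetric])
    show ?thesis
      unfolding right_diff_distrib 1 2 sum_distrib_left U_def grid_def
      by (simp add: right_diff_distrib mult.assoc)
  qed
  then show ?thesis using P.remainder_limit[OF assms(2)] by simp
qed

lemma R_eq:
  assumes "power_drift_path \<alpha> \<beta> a f (\<lambda>t. X t \<omega>) (\<lambda>t. B t \<omega>)" "0 < t"
  shows "R t \<omega> = power_drift_path.remainder \<alpha> \<beta> a f (\<lambda>t. X t \<omega>) t"
  unfolding R_def using path_limit[OF assms] by (rule limI)

text \<open>The modulus factors over the grid into exp(-\<kappa> h c_k^\<alpha>) with h = (ratio -
  1) t / m. Since t c_k^\<alpha> = (grid point / t)^(-\<gamma>\<alpha>) >= 2^(-\<gamma>\<alpha>),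
  the m exponents add up to at least \<open>\<delta>\<close>, whatever t and m are.\<close>

lemma U_char_le:
  assumes "u \<noteq> 0"
  shows "\<exists>q<1. \<forall>t>0. \<forall>m>0. cmod (char (distr M borel (U t m)) u) \<le> q * cmod (char (distr M borel (Z t)) u)"
proof -
  obtain \<kappa> where \<kappa>: "0 < \<kappa>" and modulus: "\<And>t c. 0 \<le> t \<Longrightarrow> 0 < c \<Longrightarrow>
      cmod (char (distr M borel (B t)) (u * c)) = exp (- (\<kappa> * t * c powr \<alpha>))"
    using stable_char_modulus[OF prob_space_axioms filtration stable \<alpha>_pos levy_measure
        c_nonneg c_sum_pos assms] by blast
  define \<delta> where "\<delta> = \<kappa> * (ratio - 1) * 2 powr (- (\<gamma> * \<alpha>))"
  have "0 < \<delta>" using \<kappa> ratio_bounds by (simp add: \<delta>_def)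
  have \<gamma>_pos: "0 < \<gamma>" using \<gamma>_eq p_gt_1 by simp
  have "cmod (char (distr M borel (U t m)) u) \<le> exp (- \<delta>) * cmod (char (distr M borel (Z t)) u)"
    if t: "0 < t" and m: "0 < m" for t m
  proof -
    define c where "c k = t powr (\<gamma> - 1 / \<alpha>) * grid t m k powr (-\<gamma>)" for k
    have "char (distr M borel (U t m)) u = char (distr M borel (Z t)) u *
        (\<Prod>k<m. char (distr M borel (B (grid t m (Suc k) - grid t m k))) (u * c k))"
      unfolding U_def[abs_def] c_def
    proof (rule levy_sum_char[OF prob_space_axioms filtration levy])
      show "0 \<le> grid t m 0" "Z t \<in> borel_measurable (F (grid t m 0))"
        using t Z_adapted[of t] by (auto simp: grid_def)
      show "grid t m k \<le> grid t m (Suc k)" for k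
        using grid_step[of t m k] t ratio_bounds
        by (metis diff_ge_0_iff_ge divide_nonneg_nonneg less_imp_le mult_nonneg_nonneg of_nat_0_le_iff)
    qed
    then have eq: "cmod (char (distr M borel (U t m)) u) = cmod (char (distr M borel (Z t)) u) *
        (\<Prod>k<m. cmod (char (distr M borel (B ((ratio - 1) * t / real m))) (u * c k)))"
      by (simp add: norm_mult prod_norm grid_step)
    have "(\<Prod>k<m. cmod (char (distr M borel (B ((ratio - 1) * t / real m))) (u * c k))) \<le>
        (\<Prod>k<m. exp (- \<delta> / real m))"
    proof (rule prod_mono, intro conjI norm_ge_zero)
      fix k assume "k \<in> {..<m}"
      then have gr: "t \<le> grid t m k" "grid t m k \<le> 2 * t" using grid_bounds[OF t, of k m] by auto
      have c_pos: "0 < c k" using t gr by (simp add: c_def)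
      have "2 powr (- (\<gamma> * \<alpha>)) \<le> (grid t m k / t) powr (- (\<gamma> * \<alpha>))"
        using gr t \<gamma>_pos \<alpha>_pos by (intro powr_mono2') (auto simp: field_simps)
      also have "\<dots> = t * c k powr \<alpha>"
      proof -
        have "c k powr \<alpha> = t powr (\<gamma> * \<alpha> - 1) * grid t m k powr (- (\<gamma> * \<alpha>))"
          using t gr \<alpha>_pos by (simp add: c_def powr_mult powr_powr left_diff_distrib)
        moreover have "t * t powr (\<gamma> * \<alpha> - 1) = t powr (\<gamma> * \<alpha>)"
          using t by (simp add: powr_mult_base)
        moreover have "(grid t m k / t) powr (- (\<gamma> * \<alpha>)) = grid t m k powr (- (\<gamma> * \<alpha>)) * t powr (\<gamma> * \<alpha>)"
          using t gr by (simp add: powr_divide powr_minus field_simps)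
        ultimately show ?thesis by (simp add: mult_ac)
      qed
      finally have "\<kappa> * (ratio - 1) / real m * 2 powr (- (\<gamma> * \<alpha>)) \<le> \<kappa> * (ratio - 1) / real m * (t * c k powr \<alpha>)"
        using \<kappa> ratio_bounds by (intro mult_left_mono) auto
      then have "\<delta> / real m \<le> \<kappa> * ((ratio - 1) * t / real m) * c k powr \<alpha>"
        by (simp add: \<delta>_def)
      then show "cmod (char (distr M borel (B ((ratio - 1) * t / real m))) (u * c k)) \<le> exp (- \<delta> / real m)"
        using modulus[of "(ratio - 1) * t / real m" "c k"] c_pos t ratio_bounds by simp
    qed
    also have "(\<Prod>k<m. exp (- \<delta> / real m)) = exp (- \<delta>)"
      using m by (simp add: exp_of_nat_mult[symmetric])
    finally show ?thesis
      unfolding eq by (subst mult.commute) (rule mult_right_mono[OF _ norm_ge_zero])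
  qed
  then show ?thesis using \<open>0 < \<delta>\<close> by (intro exI[of _ "exp (- \<delta>)"]) auto
qed

text \<open>The bound for \<open>U t m\<close> is uniform in m, so it survives m -> infinity: V - U
  tends to R almost surely, and dominated convergence handles the capped difference.\<close>

lemma V_char_le:
  assumes "u \<noteq> 0"
  shows "\<exists>q<1. \<forall>t>0. cmod (char (distr M borel (V t)) u) \<le>
    q * cmod (char (distr M borel (Z t)) u) + expectation (\<lambda>\<omega>. min 2 \<bar>u * R t \<omega>\<bar>)"
proof -
  obtain q where q: "q < 1" and U_le: "\<And>t m. 0 < t \<Longrightarrow> 0 < m \<Longrightarrow>
      cmod (char (distr M borel (U t m)) u) \<le> q * cmod (char (distr M borel (Z t)) u)"
    using U_char_le[OF assms] by blast
  have "cmod (char (distr M borel (V t)) u) \<le>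
    q * cmod (char (distr M borel (Z t)) u) + expectation (\<lambda>\<omega>. min 2 \<bar>u * R t \<omega>\<bar>)" if t: "0 < t" for t
  proof -
    have [measurable]: "V t \<in> borel_measurable M" "U t m \<in> borel_measurable M" "R t \<in> borel_measurable M" for m
      using t by (auto intro: V_measurable U_measurable R_measurable)
    have "(\<lambda>m. expectation (\<lambda>\<omega>. min 2 \<bar>u * (V t \<omega> - U t m \<omega>)\<bar>)) \<longlonglongrightarrow>
        expectation (\<lambda>\<omega>. min 2 \<bar>u * R t \<omega>\<bar>)"
    proof (rule integral_dominated_convergence[where w = "\<lambda>_. 2"])
      show "AE \<omega> in M. (\<lambda>m. min 2 \<bar>u * (V t \<omega> - U t m \<omega>)\<bar>) \<longlonglongrightarrow> min 2 \<bar>u * R t \<omega>\<bar>"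
        using AE_path
      proof eventually_elim
        case (elim \<omega>)
        then show ?case unfolding R_eq[OF elim t] by (intro tendsto_intros path_limit t)
      qed
    qed auto
    then have lim: "(\<lambda>m. q * cmod (char (distr M borel (Z t)) u) +
          expectation (\<lambda>\<omega>. min 2 \<bar>u * (V t \<omega> - U t m \<omega>)\<bar>)) \<longlonglongrightarrow>
        q * cmod (char (distr M borel (Z t)) u) + expectation (\<lambda>\<omega>. min 2 \<bar>u * R t \<omega>\<bar>)"
      by (intro tendsto_intros)
    have "cmod (char (distr M borel (V t)) u) \<le> q * cmod (char (distr M borel (Z t)) u) +
          expectation (\<lambda>\<omega>. min 2 \<bar>u * (V t \<omega> - U t m \<omega>)\<bar>)" if "1 \<le> m" for m
    proof -
      have "cmod (char (distr M borel (V t)) u - char (distr M borel (U t m)) u) \<le>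
          expectation (\<lambda>\<omega>. min 2 \<bar>u * (V t \<omega> - U t m \<omega>)\<bar>)"
        by (rule char_distr_diff_le) auto
      moreover have "cmod (char (distr M borel (U t m)) u) \<le> q * cmod (char (distr M borel (Z t)) u)"
        using U_le[OF t, of m] that by simp
      moreover have "cmod (char (distr M borel (V t)) u) \<le> cmod (char (distr M borel (U t m)) u) +
          cmod (char (distr M borel (V t)) u - char (distr M borel (U t m)) u)"
        by (rule norm_triangle_sub)
      ultimately show ?thesis by linarith
    qed
    then show ?thesis by (intro LIMSEQ_le_const[OF lim]) auto
  qed
  then show ?thesis using q by blast
qed

section \<open>Vanishing of the remainder in mean, after capping\<close>

definition "good K t = {\<omega>\<in>space M. \<bar>Z t \<omega>\<bar> \<le> K \<and>
  (\<forall>q\<in>\<rat>\<inter>{0..2}. \<bar>B (t * q) \<omega>\<bar> \<le> K * t powr (1 / \<alpha>))}"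

lemma good_measurable:
  assumes "0 < t"
  shows "{\<omega>\<in>space M. \<bar>Z t \<omega>\<bar> \<le> K} \<in> sets M"
    and "{\<omega>\<in>space M. \<forall>q\<in>\<rat>\<inter>{0..2}. \<bar>B (t * q) \<omega>\<bar> \<le> k} \<in> sets M"
    and "good K t \<in> sets M"
proof -
  have [measurable]: "Z t \<in> borel_measurable M" using Z_measurable assms by simp
  show 1: "{\<omega>\<in>space M. \<bar>Z t \<omega>\<bar> \<le> K} \<in> sets M" by measurable
  have 2: "{\<omega>\<in>space M. \<forall>q\<in>\<rat>\<inter>{0..2}. \<bar>B (t * q) \<omega>\<bar> \<le> k} \<in> sets M" for k
  proof (rule sets.sets_Collect_countable_All')
    show "countable (\<rat> \<inter> {0..2::real})" using countable_rat by (rule countable_subset[rotated]) auto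
    fix q :: real assume "q \<in> \<rat> \<inter> {0..2}"
    then have [measurable]: "B (t * q) \<in> borel_measurable M" using B_measurable assms by simp
    show "{\<omega>\<in>space M. \<bar>B (t * q) \<omega>\<bar> \<le> k} \<in> sets M" by measurable
  qed
  then show "{\<omega>\<in>space M. \<forall>q\<in>\<rat>\<inter>{0..2}. \<bar>B (t * q) \<omega>\<bar> \<le> k} \<in> sets M" .
  have "good K t = {\<omega>\<in>space M. \<bar>Z t \<omega>\<bar> \<le> K} \<inter>
      {\<omega>\<in>space M. \<forall>q\<in>\<rat>\<inter>{0..2}. \<bar>B (t * q) \<omega>\<bar> \<le> K * t powr (1 / \<alpha>)}"
    by (auto simp: good_def)
  then show "good K t \<in> sets M" using 1 2 by simp
qed

text \<open>Membership in \<open>good\<close> supplies exactly the hypotheses of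
  \<open>remainder_small\<close>. It is tested separately at each t: a path may enter and leave
  these events infinitely often.\<close>

lemma R_small_on_good:
  assumes "power_drift_path \<alpha> \<beta> a f (\<lambda>t. X t \<omega>) (\<lambda>t. B t \<omega>)" "0 < K" "0 < \<eta>"
  shows "eventually (\<lambda>t. \<omega> \<in> good K t \<longrightarrow> \<bar>R t \<omega>\<bar> \<le> \<eta>) at_top"
proof -
  interpret P: power_drift_path \<alpha> \<beta> a f "\<lambda>t. X t \<omega>" "\<lambda>t. B t \<omega>" by fact
  show ?thesis
    using P.remainder_small[OF assms(2,3)] eventually_gt_at_top[of 0]
  proof eventually_elim
    case (elim t)
    show ?case
    proof
      assume good: "\<omega> \<in> good K t"
      have "\<bar>P.y t\<bar> \<le> K * t powr (1 / \<alpha>)"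
        using good elim(2) by (simp add: good_def Z_def P.y_def abs_divide divide_le_eq)
      moreover have "\<forall>s\<in>{0..2 * t}. \<bar>B s \<omega>\<bar> \<le> K * t powr (1 / \<alpha>)"
        using cadlag_bounded_by_rationals[OF P.b_cadlag elim(2), of "K * t powr (1 / \<alpha>)"] good
        by (simp add: good_def)
      ultimately show "\<bar>R t \<omega>\<bar> \<le> \<eta>" using elim R_eq[OF assms(1)] by simp
    qed
  qed
qed

text \<open>On almost every path and for large n, either the indicator vanishes or R is small. The
  random threshold is harmless because only pointwise convergence is needed for dominated
  convergence.\<close>

lemma R_truncated_tendsto:
  assumes "0 < K"
  shows "(\<lambda>n. expectation (\<lambda>\<omega>. min 2 \<bar>u * R (real (Suc n)) \<omega>\<bar> *
    indicator (good K (real (Suc n))) \<omega>)) \<longlonglongrightarrow> 0"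
proof -
  let ?t = "\<lambda>n. real (Suc n)"
  have [measurable]: "R (?t n) \<in> borel_measurable M" for n by (rule R_measurable) simp
  have [measurable]: "good K (?t n) \<in> sets M" for n by (rule good_measurable) simp
  have t_top: "filterlim ?t at_top sequentially"
    by (rule filterlim_compose[OF filterlim_real_sequentially filterlim_Suc])
  have "(\<lambda>n. expectation (\<lambda>\<omega>. min 2 \<bar>u * R (?t n) \<omega>\<bar> * indicator (good K (?t n)) \<omega>)) \<longlonglongrightarrow>
      expectation (\<lambda>_. 0)"
  proof (rule integral_dominated_convergence[where w = "\<lambda>_. 2"])
    show "AE \<omega> in M. (\<lambda>n. min 2 \<bar>u * R (?t n) \<omega>\<bar> * indicator (good K (?t n)) \<omega>) \<longlonglongrightarrow> 0"
      using AE_path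
    proof eventually_elim
      case (elim \<omega>)
      show ?case
      proof (rule tendstoI)
        fix e :: real assume "0 < e"
        \<comment> \<open>Adding 1 to |u| keeps the quotient meaningful when u = 0.\<close>
        define \<eta> where "\<eta> = e / (2 * (\<bar>u\<bar> + 1))"
        have \<eta>: "0 < \<eta>" using \<open>0 < e\<close> by (simp add: \<eta>_def)
        have "\<bar>u\<bar> * \<eta> \<le> (\<bar>u\<bar> + 1) * \<eta>" using \<eta> by (intro mult_right_mono) auto
        also have "\<dots> = e / 2"
          unfolding \<eta>_def by (simp add: field_simps add_nonneg_eq_0_iff)
        finally have u\<eta>: "\<bar>u\<bar> * \<eta> < e" using \<open>0 < e\<close> by linarith
        have "eventually (\<lambda>n. \<omega> \<in> good K (?t n) \<longrightarrow> \<bar>R (?t n) \<omega>\<bar> \<le> \<eta>) sequentially"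
          using filterlim_iff[THEN iffD1, OF t_top, rule_format, OF R_small_on_good[OF elim assms \<eta>]] .
        then show "eventually (\<lambda>n. dist (min 2 \<bar>u * R (?t n) \<omega>\<bar> * indicator (good K (?t n)) \<omega>) 0 < e) sequentially"
        proof eventually_elim
          case (elim n)
          show ?case
          proof (cases "\<omega> \<in> good K (?t n)")
            case True
            then have "\<bar>u * R (?t n) \<omega>\<bar> \<le> \<bar>u\<bar> * \<eta>"
              using elim by (auto simp: abs_mult intro: mult_left_mono)
            then have "\<bar>min 2 \<bar>u * R (?t n) \<omega>\<bar>\<bar> < e" using u\<eta> by linarith
            then show ?thesis using True by simp
          next
            case False
            then show ?thesis using \<open>0 < e\<close> by simp
          qed
        qed
      qed
    qed
    show "AE \<omega> in M. norm (min 2 \<bar>u * R (?t n) \<omega>\<bar> * indicator (good K (?t n)) \<omega>) \<le> 2" for n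
      by (auto simp: indicator_def)
    show "(\<lambda>\<omega>. min 2 \<bar>u * R (?t n) \<omega>\<bar> * indicator (good K (?t n)) \<omega>) \<in> borel_measurable M" for n
      by measurable
  qed auto
  then show ?thesis by simp
qed

text \<open>The assumed convergence makes Z tight and scaling makes the supremum of B tight, so the
  complement of \<open>good\<close> has small probability uniformly in large n; on
  \<open>good\<close> the truncated estimate applies.\<close>

lemma R_expectation_tendsto:
  assumes \<mu>: "real_distribution \<mu>" "weak_conv_m (\<lambda>n. distr M borel (Z (real (Suc n)))) \<mu>"
  shows "(\<lambda>n. expectation (\<lambda>\<omega>. min 2 \<bar>u * R (real (Suc n)) \<omega>\<bar>)) \<longlonglongrightarrow> 0"
proof (rule tendstoI)
  fix e :: real assume e: "0 < e"
  let ?t = "\<lambda>n. real (Suc n)"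
  let ?S = "\<lambda>K t. {\<omega>\<in>space M. \<forall>q\<in>\<rat>\<inter>{0..2}. \<bar>B (t * q) \<omega>\<bar> \<le> K * t powr (1 / \<alpha>)}"
  have rd: "real_distribution (distr M borel (Z (?t n)))" for n
    using Z_measurable[of "?t n"] by simp
  obtain K1 where K1: "\<And>K. K1 \<le> K \<Longrightarrow>
      eventually (\<lambda>n. 1 - e / 8 \<le> measure (distr M borel (Z (?t n))) {-K..K}) sequentially"
    using weak_conv_m_tight[OF rd \<mu>, of "e / 8"] e by auto
  obtain K2 where K2: "\<And>K t. K2 \<le> K \<Longrightarrow> 0 < t \<Longrightarrow> 1 - e / 8 \<le> prob (?S K t)"
    using stable_sup_tight[OF prob_space_axioms filtration stable, of "e / 8"] e by auto
  define K where "K = max 1 (max K1 K2)"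
  have K: "0 < K" "K1 \<le> K" "K2 \<le> K" by (auto simp: K_def)
  have R_meas: "R (?t n) \<in> borel_measurable M" for n by (rule R_measurable) simp
  have good_meas: "good K (?t n) \<in> sets M" for n by (rule good_measurable) simp
  have "eventually (\<lambda>n. expectation (\<lambda>\<omega>. min 2 \<bar>u * R (?t n) \<omega>\<bar> * indicator (good K (?t n)) \<omega>) < e / 2) sequentially"
    by (rule order_tendstoD(2)[OF R_truncated_tendsto[OF K(1)]]) (use e in simp)
  then show "eventually (\<lambda>n. dist (expectation (\<lambda>\<omega>. min 2 \<bar>u * R (?t n) \<omega>\<bar>)) 0 < e) sequentially"
    using K1[OF K(2)]
  proof eventually_elim
    case (elim n)
    let ?G = "good K (?t n)"
    let ?A = "{\<omega>\<in>space M. \<bar>Z (?t n) \<omega>\<bar> \<le> K}"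
    have t: "0 < ?t n" by simp
    have A: "?A \<in> events" and S: "?S K (?t n) \<in> events"
      using good_measurable(1,2)[OF t] by auto
    have "measure (distr M borel (Z (?t n))) {-K..K} = prob ?A"
      using Z_measurable[of "?t n"]
      by (subst measure_distr) (auto intro!: arg_cong[where f = prob] simp: abs_le_iff minus_le_iff)
    then have "prob (space M - ?A) \<le> e / 8"
      using elim(2) prob_compl[OF A] by simp
    moreover have "prob (space M - ?S K (?t n)) \<le> e / 8"
      using K2[OF K(3) t] prob_compl[OF S] by simp
    moreover have "prob (space M - ?G) \<le> prob ((space M - ?A) \<union> (space M - ?S K (?t n)))"
      using A S by (intro finite_measure_mono) (auto simp: good_def)
    moreover have "\<dots> \<le> prob (space M - ?A) + prob (space M - ?S K (?t n))"
      using A S by (intro measure_Un_le) auto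
    \<comment> \<open>The capped variable is at most 2, so this complement costs at most e/2; the
      part on \<open>good\<close> is below e/2.\<close>
    ultimately have compl: "prob (space M - ?G) \<le> e / 4" by linarith
    have R_min_meas: "(\<lambda>\<omega>. min 2 \<bar>u * R (?t n) \<omega>\<bar>) \<in> borel_measurable M"
      by (intro borel_measurable_min borel_measurable_abs borel_measurable_times borel_measurable_const R_meas)
    have bounded_int: "integrable M k" if "k \<in> borel_measurable M" "\<And>\<omega>. \<bar>k \<omega>\<bar> \<le> 2" for k :: "'a \<Rightarrow> real"
      by (rule integrable_const_bound[where B = 2]) (use that in auto)
    have "expectation (\<lambda>\<omega>. min 2 \<bar>u * R (?t n) \<omega>\<bar>) \<le>
        expectation (\<lambda>\<omega>. min 2 \<bar>u * R (?t n) \<omega>\<bar> * indicator ?G \<omega> + 2 * indicator (space M - ?G) \<omega>)"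
    proof (rule integral_mono)
      show "integrable M (\<lambda>\<omega>. min 2 \<bar>u * R (?t n) \<omega>\<bar>)"
        by (rule bounded_int[OF R_min_meas]) simp
      show "integrable M (\<lambda>\<omega>. min 2 \<bar>u * R (?t n) \<omega>\<bar> * indicator ?G \<omega> + 2 * indicator (space M - ?G) \<omega>)"
        by (rule bounded_int; (intro borel_measurable_add borel_measurable_times R_min_meas
          borel_measurable_const borel_measurable_indicator sets.Diff sets.top good_meas)?) (simp add: indicator_def)
    qed (auto simp: indicator_def)
    also have "\<dots> = expectation (\<lambda>\<omega>. min 2 \<bar>u * R (?t n) \<omega>\<bar> * indicator ?G \<omega>) + 2 * prob (space M - ?G)"
    proof (subst Bochner_Integration.integral_add)
      show "integrable M (\<lambda>\<omega>. min 2 \<bar>u * R (?t n) \<omega>\<bar> * indicator ?G \<omega>)"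
        by (rule bounded_int; (intro borel_measurable_add borel_measurable_times R_min_meas
          borel_measurable_const borel_measurable_indicator sets.Diff sets.top good_meas)?) (simp add: indicator_def)
      show "integrable M (\<lambda>\<omega>. 2 * indicator (space M - ?G) \<omega> :: real)"
        by (rule bounded_int; (intro borel_measurable_add borel_measurable_times R_min_meas
          borel_measurable_const borel_measurable_indicator sets.Diff sets.top good_meas)?) (simp add: indicator_def)
    qed (simp add: Int_absorb2)
    also have "\<dots> < e" using elim(1) compl by linarith
    finally have "expectation (\<lambda>\<omega>. min 2 \<bar>u * R (?t n) \<omega>\<bar>) < e" .
    moreover have "0 \<le> expectation (\<lambda>\<omega>. min 2 \<bar>u * R (?t n) \<omega>\<bar>)"
      by (intro integral_nonneg_AE) auto
    ultimately show ?case by simp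
  qed
qed

text \<open>The times n + 1 and ratio (n + 1) both give the limit \<mu>, so the characteristic
  functions of Z and V tend to those of \<mu> at u and at d u. The hypothesis speaks of sequences
  because the continuity theorem used is sequential.\<close>

lemma no_weak_limit:
  assumes \<mu>: "real_distribution \<mu>"
    and conv: "\<And>t. filterlim t at_top sequentially \<Longrightarrow> (\<And>n. 0 < t n) \<Longrightarrow>
      weak_conv_m (\<lambda>n. distr M borel (Z (t n))) \<mu>"
  shows False
proof -
  let ?t = "\<lambda>n. real (Suc n)"
  define d where "d = ratio powr (1 / \<alpha> - \<gamma>)"
  have d: "0 < d" "d < 1"
    using ratio_bounds \<gamma>_gt by (auto simp: d_def powr_less_one)
  have t_top: "filterlim ?t at_top sequentially"
    by (rule filterlim_compose[OF filterlim_real_sequentially filterlim_Suc])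
  have rt_top: "filterlim (\<lambda>n. ratio * ?t n) at_top sequentially"
    using ratio_bounds by (intro filterlim_tendsto_pos_mult_at_top[OF tendsto_const _ t_top]) auto
  have conv1: "weak_conv_m (\<lambda>n. distr M borel (Z (?t n))) \<mu>"
    by (rule conv[OF t_top]) simp
  have conv2: "weak_conv_m (\<lambda>n. distr M borel (Z (ratio * ?t n))) \<mu>"
    by (rule conv[OF rt_top]) (use ratio_bounds in simp)
  have rd: "real_distribution (distr M borel (Z s))" if "0 \<le> s" for s
    using Z_measurable[OF that] by simp
  have char1: "(\<lambda>n. char (distr M borel (Z (?t n))) u) \<longlonglongrightarrow> char \<mu> u" for u
    by (rule levy_continuity1[OF rd \<mu> conv1]) simp
  have char2: "(\<lambda>n. char (distr M borel (V (?t n))) u) \<longlonglongrightarrow> char \<mu> (d * u)" for u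
  proof -
    have "(\<lambda>n. char (distr M borel (Z (ratio * ?t n))) (u * d)) \<longlonglongrightarrow> char \<mu> (u * d)"
      by (rule levy_continuity1[OF rd \<mu> conv2]) (use ratio_bounds in simp)
    moreover have "char (distr M borel (V (?t n))) u = char (distr M borel (Z (ratio * ?t n))) (u * d)" for n
      unfolding V_def[abs_def] d_def
      by (rule char_distr_cmult) (use ratio_bounds in \<open>auto intro!: Z_measurable\<close>)
    ultimately show ?thesis by (simp add: mult.commute)
  qed
  have contr: "\<exists>q<1. cmod (char \<mu> (d * u)) \<le> q * cmod (char \<mu> u)" if u: "u \<noteq> 0" for u
  proof -
    obtain q where q: "q < 1" and le: "\<And>t. 0 < t \<Longrightarrow> cmod (char (distr M borel (V t)) u) \<le>
        q * cmod (char (distr M borel (Z t)) u) + expectation (\<lambda>\<omega>. min 2 \<bar>u * R t \<omega>\<bar>)"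
      using V_char_le[OF u] by blast
    have "cmod (char \<mu> (d * u)) \<le> q * cmod (char \<mu> u) + 0"
    proof (rule LIMSEQ_le)
      show "(\<lambda>n. cmod (char (distr M borel (V (?t n))) u)) \<longlonglongrightarrow> cmod (char \<mu> (d * u))"
        by (intro tendsto_norm char2)
      show "(\<lambda>n. q * cmod (char (distr M borel (Z (?t n))) u) +
          expectation (\<lambda>\<omega>. min 2 \<bar>u * R (?t n) \<omega>\<bar>)) \<longlonglongrightarrow> q * cmod (char \<mu> u) + 0"
        by (intro tendsto_intros char1 R_expectation_tendsto[OF \<mu> conv1])
      show "\<exists>N. \<forall>n\<ge>N. cmod (char (distr M borel (V (?t n))) u) \<le>
          q * cmod (char (distr M borel (Z (?t n))) u) + expectation (\<lambda>\<omega>. min 2 \<bar>u * R (?t n) \<omega>\<bar>)"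
        using le by (intro exI[of _ 0]) simp
    qed
    then show ?thesis using q by auto
  qed
  obtain q where "q < 1" "cmod (char \<mu> (d * 1)) \<le> q * cmod (char \<mu> 1)" using contr[of 1] by auto
  moreover have "cmod (char \<mu> (d * u)) \<le> cmod (char \<mu> u)" if u: "u \<noteq> 0" for u
  proof -
    obtain q where "q < 1" "cmod (char \<mu> (d * u)) \<le> q * cmod (char \<mu> u)" using contr[OF u] by blast
    moreover have "q * cmod (char \<mu> u) \<le> 1 * cmod (char \<mu> u)"
      using \<open>q < 1\<close> by (intro mult_right_mono) auto
    ultimately show ?thesis by simp
  qed
  ultimately show False using char_contraction_False[OF \<mu>, of d q] d by simp
qed

end

theorem proposition2p9:
  fixes M :: "'a measure" and F :: "real \<Rightarrow> 'a measure"
    and B X :: "real \<Rightarrow> 'a \<Rightarrow> real"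
    and f :: "real \<Rightarrow> real"
    and \<alpha> \<beta> a c_pos c_neg c1 r :: real
  assumes "0 < \<alpha>" and "\<alpha> < 2" and "\<alpha> \<noteq> 1"
    and "0 < a"
    and "1 / (1 + \<alpha>) < \<beta>" and "\<beta> < 1"
    and "c1 = (a * (1 - \<beta>)) powr (1 / (1 - \<beta>))"
    and "r = (\<alpha> + \<beta> - 1) / \<alpha>"
    and "0 \<le> c_pos" and "0 \<le> c_neg" and "0 < c_pos + c_neg"
    and "prob_space M" and "filtration_on M F"
    and "strictly_stable_process M F \<alpha> B"
    and "has_levy_measure M B (stable_levy_measure \<alpha> c_pos c_neg)"
    and "f C1_differentiable_on UNIV"
    and "deriv (\<lambda>x. ln (f x)) \<in> O[at_top](\<lambda>x. 1 / x)"
    and "(\<lambda>x. f x - a * x powr \<beta>) \<in> o[at_top](\<lambda>x. x powr (\<beta> - r))"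
    and "sde_solution M F f B X"
    and "AE \<omega> in M. filterlim (\<lambda>t. X t \<omega>) at_top at_top"
  shows "\<not> converges_in_distribution M
           (\<lambda>t \<omega>. (X t \<omega> - c1 * t powr (1 / (1 - \<beta>))) / t powr (1 / \<alpha>)) at_top"
proof
  assume "converges_in_distribution M
           (\<lambda>t \<omega>. (X t \<omega> - c1 * t powr (1 / (1 - \<beta>))) / t powr (1 / \<alpha>)) at_top"
  then obtain \<mu> where \<mu>: "real_distribution \<mu>" and conv: "\<And>x. isCont (cdf \<mu>) x \<Longrightarrow>
      ((\<lambda>t. cdf (distr M borel (\<lambda>\<omega>. (X t \<omega> - c1 * t powr (1 / (1 - \<beta>))) / t powr (1 / \<alpha>))) x)
        \<longlongrightarrow> cdf \<mu> x) at_top"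
    unfolding converges_in_distribution_def by blast
  interpret power_drift \<alpha> \<beta> a f
    using assms by unfold_locales (auto intro: C1_differentiable_imp_continuous_on)
  interpret prob_space M by fact
  interpret stable_drift_sde \<alpha> \<beta> a f M F B X c_pos c_neg
    using assms by unfold_locales
  have Z: "(\<lambda>\<omega>. (X t \<omega> - c1 * t powr (1 / (1 - \<beta>))) / t powr (1 / \<alpha>)) = Z t" for t
    using assms(7) by (simp add: Z_def[abs_def] g_def c1_def p_def)
  show False
  proof (rule no_weak_limit[OF \<mu>])
    \<comment> \<open>Convergence of the distribution functions along \<open>at_top\<close> passes
      to every sequence of times tending to infinity.\<close>
    fix t :: "nat \<Rightarrow> real" assume "filterlim t at_top sequentially"
    then show "weak_conv_m (\<lambda>n. distr M borel (Z (t n))) \<mu>"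
      unfolding weak_conv_m_def weak_conv_def
      using filterlim_compose[OF conv] unfolding Z by blast
  qed
qed

end
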